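(* Let $\mathcal V$ be a distributive, cartesian monoidal category with finite limits, with terminal object $\mathbf 1$. Then there is an adjunction $-\ast\mathbf 1\dashv\mathcal V(\mathbf 1,-)\colon\mathsf{Span}(\mathcal V)\to\mathcal V\text{-}\mathsf{Mat}$ in the 2-category $\mathsf{Grph}(\mathsf{Cat})$ of internal $\mathsf{Cat}$-graphs, with left adjoint $-\ast\mathbf 1\colon\mathcal V\text{-}\mathsf{Mat}\to\mathsf{Span}(\mathcal V)$.
   Context: Distributive: $\mathcal V$ has small coproducts, and $\times$ preserves them in each variable. $X\ast\mathbf 1=\sum_{x\in X}\mathbf 1$ for a set $X$; $-\ast\mathbf 1\colon\mathsf{Set}\to\mathcal V$ is left adjoint to $\mathcal V(\mathbf 1,-)$. $\mathsf{Grph}(\mathsf{Cat})$ is the functor 2-category $[\,\cdot_1\rightrightarrows\cdot_0,\mathsf{Cat}]$: objects are parallel pairs of functors $\mathbb G_1\rightrightarrows\mathbb G_0$, morphisms are pairs of functors commuting with them, 2-cells are pairs of natural transformations compatible with them. $\mathsf{Span}(\mathcal V)$: $\mathbb G_0=\mathcal V$; objects of $\mathbb G_1$ are spans $p=(X\xleftarrow{l_p}M_p\xrightarrow{r_p}Y)$ and morphisms are triples $(f,\theta,g)$ of morphisms making both squares commute. $\mathcal V\text{-}\mathsf{Mat}$: $\mathbb G_0=\mathsf{Set}$; objects of $\mathbb G_1$ are $\mathcal V$-matrices $p\colon X\nrightarrow Y$, i.e. families $p(x,y)\in\mathcal V$ ($x\in X,y\in Y$), and morphisms $p\to q$ over functions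 $f,g$ are families $p(x,y)\to q(fx,gy)$. The graph morphism $-\ast\mathbf 1$ is $X\mapsto X\ast\mathbf 1$ on 0-cells and sends a matrix $p$ to the span $X\ast\mathbf 1\leftarrow\sum_{x,y}p(x,y)\to Y\ast\mathbf 1$ whose legs restrict on $p(x,y)$ to $p(x,y)\to\mathbf 1\xrightarrow{x}X\ast\mathbf 1$ and $p(x,y)\to\mathbf 1\xrightarrow{y}Y\ast\mathbf 1$ (and acts on 2-cells by coproducts). The graph morphism $\mathcal V(\mathbf 1,-)$ is $V\mapsto\mathcal V(\mathbf 1,V)$ on 0-cells and sends a span $s\colon V\nrightarrow W$ to the matrix $\mathcal V(\mathbf 1,V)\nrightarrow\mathcal V(\mathbf 1,W)$ whose $(v,w)$ entry is the pullback of $\langle l_s,r_s\rangle\colon M_s\to V\times W$ along $\langle v,w\rangle\colon\mathbf 1\to V\times W$ (and acts on 2-cells by the induced maps of pullbacks). *)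

theory Defs
  imports Main "HOL-Library.FuncSet" "HOL-Library.Equipollence"
begin

section \<open>Categories, functors, natural transformations\<close>

text \<open>Hom-sets are indexed by objects and need not be disjoint; accordingly composition carries its
  three objects: \<open>Comp C a b c g f\<close> is \<open>g \<circ> f\<close> for \<open>f \<in> Hom C a b\<close>, \<open>g \<in> Hom C b c\<close>.\<close>

record ('o, 'm) cat_data =
  Obj :: "'o set"
  Hom :: "'o \<Rightarrow> 'o \<Rightarrow> 'm set"
  Id :: "'o \<Rightarrow> 'm"
  Comp :: "'o \<Rightarrow> 'o \<Rightarrow> 'o \<Rightarrow> 'm \<Rightarrow> 'm \<Rightarrow> 'm"

locale category =
  fixes C :: "('o, 'm) cat_data"
  assumes Id_in_Hom: "a \<in> Obj C \<Longrightarrow> Id C a \<in> Hom C a a"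
    and Comp_in_Hom: "\<lbrakk>a \<in> Obj C; b \<in> Obj C; c \<in> Obj C; f \<in> Hom C a b; g \<in> Hom C b c\<rbrakk>
      \<Longrightarrow> Comp C a b c g f \<in> Hom C a c"
    and Comp_Id_right: "\<lbrakk>a \<in> Obj C; b \<in> Obj C; f \<in> Hom C a b\<rbrakk> \<Longrightarrow> Comp C a a b f (Id C a) = f"
    and Comp_Id_left: "\<lbrakk>a \<in> Obj C; b \<in> Obj C; f \<in> Hom C a b\<rbrakk> \<Longrightarrow> Comp C a b b (Id C b) f = f"
    and Comp_assoc: "\<lbrakk>a \<in> Obj C; b \<in> Obj C; c \<in> Obj C; d \<in> Obj C;
        f \<in> Hom C a b; g \<in> Hom C b c; h \<in> Hom C c d\<rbrakk>
      \<Longrightarrow> Comp C a c d h (Comp C a b c g f) = Comp C a b d (Comp C b c d h g) f"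

record ('o, 'm, 'p, 'n) functor_data =
  Fob :: "'o \<Rightarrow> 'p"
  Far :: "'o \<Rightarrow> 'o \<Rightarrow> 'm \<Rightarrow> 'n"

locale cat_functor = A: category A + B: category B
  for A :: "('o, 'm) cat_data" and B :: "('p, 'n) cat_data" +
  fixes F :: "('o, 'm, 'p, 'n) functor_data"
  assumes Fob_in_Obj: "a \<in> Obj A \<Longrightarrow> Fob F a \<in> Obj B"
    and Far_in_Hom: "\<lbrakk>a \<in> Obj A; b \<in> Obj A; f \<in> Hom A a b\<rbrakk>
      \<Longrightarrow> Far F a b f \<in> Hom B (Fob F a) (Fob F b)"
    and Far_Id: "a \<in> Obj A \<Longrightarrow> Far F a a (Id A a) = Id B (Fob F a)"
    and Far_Comp: "\<lbrakk>a \<in> Obj A; b \<in> Obj A; c \<in> Obj A; f \<in> Hom A a b; g \<in> Hom A b c\<rbrakk>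
      \<Longrightarrow> Far F a c (Comp A a b c g f)
        = Comp B (Fob F a) (Fob F b) (Fob F c) (Far F b c g) (Far F a b f)"

definition functor_eq ::
  "('o, 'm) cat_data \<Rightarrow> ('o, 'm, 'p, 'n) functor_data \<Rightarrow> ('o, 'm, 'p, 'n) functor_data \<Rightarrow> bool" where
  "functor_eq A F G \<longleftrightarrow> (\<forall>a \<in> Obj A. Fob F a = Fob G a) \<and>
     (\<forall>a \<in> Obj A. \<forall>b \<in> Obj A. \<forall>f \<in> Hom A a b. Far F a b f = Far G a b f)"

definition functor_id :: "('o, 'm, 'o, 'm) functor_data" where
  "functor_id = \<lparr>Fob = (\<lambda>a. a), Far = (\<lambda>a b f. f)\<rparr>"

definition functor_comp ::
  "('p, 'n, 'q, 'k) functor_data \<Rightarrow> ('o, 'm, 'p, 'n) functor_data \<Rightarrow> ('o, 'm, 'q, 'k) functor_data" where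
  "functor_comp G F = \<lparr>Fob = (\<lambda>a. Fob G (Fob F a)),
     Far = (\<lambda>a b f. Far G (Fob F a) (Fob F b) (Far F a b f))\<rparr>"

locale nat_trans = F: cat_functor A B F + G: cat_functor A B G
  for A :: "('o, 'm) cat_data" and B :: "('p, 'n) cat_data"
    and F :: "('o, 'm, 'p, 'n) functor_data" and G :: "('o, 'm, 'p, 'n) functor_data" +
  fixes \<alpha> :: "'o \<Rightarrow> 'n"
  assumes component: "a \<in> Obj A \<Longrightarrow> \<alpha> a \<in> Hom B (Fob F a) (Fob G a)"
    and naturality: "\<lbrakk>a \<in> Obj A; b \<in> Obj A; f \<in> Hom A a b\<rbrakk>
      \<Longrightarrow> Comp B (Fob F a) (Fob F b) (Fob G b) (\<alpha> b) (Far F a b f)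
        = Comp B (Fob F a) (Fob G a) (Fob G b) (Far G a b f) (\<alpha> a)"

definition nat_eq :: "('o, 'm) cat_data \<Rightarrow> ('o \<Rightarrow> 'n) \<Rightarrow> ('o \<Rightarrow> 'n) \<Rightarrow> bool" where
  "nat_eq A \<alpha> \<beta> \<longleftrightarrow> (\<forall>a \<in> Obj A. \<alpha> a = \<beta> a)"

definition nat_id :: "('p, 'n) cat_data \<Rightarrow> ('o, 'm, 'p, 'n) functor_data \<Rightarrow> 'o \<Rightarrow> 'n" where
  "nat_id B F = (\<lambda>a. Id B (Fob F a))"

text \<open>The vertical composite of \<open>\<alpha>: F \<Rightarrow> G\<close> and \<open>\<beta>: G \<Rightarrow> H\<close>.\<close>

definition nat_vcomp :: "('p, 'n) cat_data \<Rightarrow> ('o, 'm, 'p, 'n) functor_data \<Rightarrow>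
    ('o, 'm, 'p, 'n) functor_data \<Rightarrow> ('o, 'm, 'p, 'n) functor_data \<Rightarrow>
    ('o \<Rightarrow> 'n) \<Rightarrow> ('o \<Rightarrow> 'n) \<Rightarrow> 'o \<Rightarrow> 'n" where
  "nat_vcomp B F G H \<beta> \<alpha> = (\<lambda>a. Comp B (Fob F a) (Fob G a) (Fob H a) (\<beta> a) (\<alpha> a))"

text \<open>The whiskerings \<open>K \<alpha>: K F \<Rightarrow> K G\<close> and \<open>\<alpha> E: F E \<Rightarrow> G E\<close> of \<open>\<alpha>: F \<Rightarrow> G\<close>.\<close>

definition post_whisker :: "('p, 'n, 'q, 'k) functor_data \<Rightarrow> ('o, 'm, 'p, 'n) functor_data \<Rightarrow>
    ('o, 'm, 'p, 'n) functor_data \<Rightarrow> ('o \<Rightarrow> 'n) \<Rightarrow> 'o \<Rightarrow> 'k" where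
  "post_whisker K F G \<alpha> = (\<lambda>a. Far K (Fob F a) (Fob G a) (\<alpha> a))"

definition pre_whisker :: "('p \<Rightarrow> 'k) \<Rightarrow> ('o, 'm, 'p, 'n) functor_data \<Rightarrow> 'o \<Rightarrow> 'k" where
  "pre_whisker \<alpha> E = (\<lambda>a. \<alpha> (Fob E a))"


section \<open>The 2-category of internal graphs in \<open>Cat\<close>\<close>

text \<open>Objects of a 2-category all live in one HOL type, whereas the graphs below have different
  types. The 1-cells, 2-cells and operations of the functor 2-category are therefore given
  polymorphically; equations between 1-cells and 2-cells are equations on the carriers.\<close>

record ('o0, 'm0, 'o1, 'm1) graph_data =
  G0 :: "('o0, 'm0) cat_data"
  G1 :: "('o1, 'm1) cat_data"
  Src :: "('o1, 'm1, 'o0, 'm0) functor_data"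
  Tgt :: "('o1, 'm1, 'o0, 'm0) functor_data"

locale cat_graph =
  fixes G :: "('o0, 'm0, 'o1, 'm1) graph_data"
  assumes Src_functor: "cat_functor (G1 G) (G0 G) (Src G)"
    and Tgt_functor: "cat_functor (G1 G) (G0 G) (Tgt G)"

record ('o0, 'm0, 'o1, 'm1, 'p0, 'n0, 'p1, 'n1) graph_mor =
  M0 :: "('o0, 'm0, 'p0, 'n0) functor_data"
  M1 :: "('o1, 'm1, 'p1, 'n1) functor_data"

locale graph_morphism = G: cat_graph G + H: cat_graph H
  for G :: "('o0, 'm0, 'o1, 'm1) graph_data" and H :: "('p0, 'n0, 'p1, 'n1) graph_data" +
  fixes F :: "('o0, 'm0, 'o1, 'm1, 'p0, 'n0, 'p1, 'n1) graph_mor"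
  assumes M0_functor: "cat_functor (G0 G) (G0 H) (M0 F)"
    and M1_functor: "cat_functor (G1 G) (G1 H) (M1 F)"
    and Src_commutes: "functor_eq (G1 G) (functor_comp (Src H) (M1 F)) (functor_comp (M0 F) (Src G))"
    and Tgt_commutes: "functor_eq (G1 G) (functor_comp (Tgt H) (M1 F)) (functor_comp (M0 F) (Tgt G))"

definition graph_mor_id :: "('o0, 'm0, 'o1, 'm1, 'o0, 'm0, 'o1, 'm1) graph_mor" where
  "graph_mor_id = \<lparr>M0 = functor_id, M1 = functor_id\<rparr>"

definition graph_mor_comp :: "('p0, 'n0, 'p1, 'n1, 'q0, 'k0, 'q1, 'k1) graph_mor \<Rightarrow>
    ('o0, 'm0, 'o1, 'm1, 'p0, 'n0, 'p1, 'n1) graph_mor \<Rightarrow>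
    ('o0, 'm0, 'o1, 'm1, 'q0, 'k0, 'q1, 'k1) graph_mor" where
  "graph_mor_comp E F = \<lparr>M0 = functor_comp (M0 E) (M0 F), M1 = functor_comp (M1 E) (M1 F)\<rparr>"

type_synonym ('o0, 'n0, 'o1, 'n1) graph_cell = "('o0 \<Rightarrow> 'n0) \<times> ('o1 \<Rightarrow> 'n1)"

locale graph_2cell = F: graph_morphism G H F + E: graph_morphism G H E
  for G :: "('o0, 'm0, 'o1, 'm1) graph_data" and H :: "('p0, 'n0, 'p1, 'n1) graph_data"
    and F :: "('o0, 'm0, 'o1, 'm1, 'p0, 'n0, 'p1, 'n1) graph_mor"
    and E :: "('o0, 'm0, 'o1, 'm1, 'p0, 'n0, 'p1, 'n1) graph_mor" +
  fixes \<alpha> :: "('o0, 'n0, 'o1, 'n1) graph_cell"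
  assumes nat_trans0: "nat_trans (G0 G) (G0 H) (M0 F) (M0 E) (fst \<alpha>)"
    and nat_trans1: "nat_trans (G1 G) (G1 H) (M1 F) (M1 E) (snd \<alpha>)"
    and Src_compatible:
      "nat_eq (G1 G) (post_whisker (Src H) (M1 F) (M1 E) (snd \<alpha>)) (pre_whisker (fst \<alpha>) (Src G))"
    and Tgt_compatible:
      "nat_eq (G1 G) (post_whisker (Tgt H) (M1 F) (M1 E) (snd \<alpha>)) (pre_whisker (fst \<alpha>) (Tgt G))"

definition cell_eq :: "('o0, 'm0, 'o1, 'm1) graph_data \<Rightarrow>
    ('o0, 'n0, 'o1, 'n1) graph_cell \<Rightarrow> ('o0, 'n0, 'o1, 'n1) graph_cell \<Rightarrow> bool" where
  "cell_eq G \<alpha> \<beta> \<longleftrightarrow> nat_eq (G0 G) (fst \<alpha>) (fst \<beta>) \<and> nat_eq (G1 G) (snd \<alpha>) (snd \<beta>)"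

definition cell_id :: "('p0, 'n0, 'p1, 'n1) graph_data \<Rightarrow>
    ('o0, 'm0, 'o1, 'm1, 'p0, 'n0, 'p1, 'n1) graph_mor \<Rightarrow> ('o0, 'n0, 'o1, 'n1) graph_cell" where
  "cell_id H F = (nat_id (G0 H) (M0 F), nat_id (G1 H) (M1 F))"

definition cell_vcomp :: "('p0, 'n0, 'p1, 'n1) graph_data \<Rightarrow>
    ('o0, 'm0, 'o1, 'm1, 'p0, 'n0, 'p1, 'n1) graph_mor \<Rightarrow>
    ('o0, 'm0, 'o1, 'm1, 'p0, 'n0, 'p1, 'n1) graph_mor \<Rightarrow>
    ('o0, 'm0, 'o1, 'm1, 'p0, 'n0, 'p1, 'n1) graph_mor \<Rightarrow>
    ('o0, 'n0, 'o1, 'n1) graph_cell \<Rightarrow> ('o0, 'n0, 'o1, 'n1) graph_cell \<Rightarrow>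
    ('o0, 'n0, 'o1, 'n1) graph_cell" where
  "cell_vcomp H F E D \<beta> \<alpha> =
     (nat_vcomp (G0 H) (M0 F) (M0 E) (M0 D) (fst \<beta>) (fst \<alpha>),
      nat_vcomp (G1 H) (M1 F) (M1 E) (M1 D) (snd \<beta>) (snd \<alpha>))"

definition cell_post_whisker :: "('p0, 'n0, 'p1, 'n1, 'q0, 'k0, 'q1, 'k1) graph_mor \<Rightarrow>
    ('o0, 'm0, 'o1, 'm1, 'p0, 'n0, 'p1, 'n1) graph_mor \<Rightarrow>
    ('o0, 'm0, 'o1, 'm1, 'p0, 'n0, 'p1, 'n1) graph_mor \<Rightarrow>
    ('o0, 'n0, 'o1, 'n1) graph_cell \<Rightarrow> ('o0, 'k0, 'o1, 'k1) graph_cell" where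
  "cell_post_whisker K F E \<alpha> =
     (post_whisker (M0 K) (M0 F) (M0 E) (fst \<alpha>), post_whisker (M1 K) (M1 F) (M1 E) (snd \<alpha>))"

definition cell_pre_whisker :: "('p0, 'k0, 'p1, 'k1) graph_cell \<Rightarrow>
    ('o0, 'm0, 'o1, 'm1, 'p0, 'n0, 'p1, 'n1) graph_mor \<Rightarrow> ('o0, 'k0, 'o1, 'k1) graph_cell" where
  "cell_pre_whisker \<alpha> E = (pre_whisker (fst \<alpha>) (M0 E), pre_whisker (snd \<alpha>) (M1 E))"

text \<open>Adjunction \<open>L \<stileturn> R: H \<rightarrow> G\<close> with unit \<open>\<eta>\<close> and counit \<open>\<epsilon>\<close>; the last two assumptions are
  \<open>\<epsilon>L \<cdot> L\<eta> = 1\<close> and \<open>R\<epsilon> \<cdot> \<eta>R = 1\<close>.\<close>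

locale graph_adjunction = L: graph_morphism G H L + R: graph_morphism H G R
  for G :: "('o0, 'm0, 'o1, 'm1) graph_data" and H :: "('p0, 'n0, 'p1, 'n1) graph_data"
    and L :: "('o0, 'm0, 'o1, 'm1, 'p0, 'n0, 'p1, 'n1) graph_mor"
    and R :: "('p0, 'n0, 'p1, 'n1, 'o0, 'm0, 'o1, 'm1) graph_mor" +
  fixes \<eta> :: "('o0, 'm0, 'o1, 'm1) graph_cell"
    and \<epsilon> :: "('p0, 'n0, 'p1, 'n1) graph_cell"
  assumes unit: "graph_2cell G G graph_mor_id (graph_mor_comp R L) \<eta>"
    and counit: "graph_2cell H H (graph_mor_comp L R) graph_mor_id \<epsilon>"
    and triangle_L: "cell_eq G
      (cell_vcomp H L (graph_mor_comp L (graph_mor_comp R L)) L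
        (cell_pre_whisker \<epsilon> L) (cell_post_whisker L graph_mor_id (graph_mor_comp R L) \<eta>))
      (cell_id H L)"
    and triangle_R: "cell_eq H
      (cell_vcomp G R (graph_mor_comp R (graph_mor_comp L R)) R
        (cell_post_whisker R (graph_mor_comp L R) graph_mor_id \<epsilon>) (cell_pre_whisker \<eta> R))
      (cell_id G R)"


section \<open>Limits and coproducts\<close>

definition is_cone :: "('i, 'j) cat_data \<Rightarrow> ('o, 'm) cat_data \<Rightarrow> ('i, 'j, 'o, 'm) functor_data \<Rightarrow>
    'o \<Rightarrow> ('i \<Rightarrow> 'm) \<Rightarrow> bool" where
  "is_cone J C D c \<pi> \<longleftrightarrow> c \<in> Obj C \<and> (\<forall>i \<in> Obj J. \<pi> i \<in> Hom C c (Fob D i)) \<and>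
     (\<forall>i \<in> Obj J. \<forall>j \<in> Obj J. \<forall>u \<in> Hom J i j.
        Comp C c (Fob D i) (Fob D j) (Far D i j u) (\<pi> i) = \<pi> j)"

definition is_limit :: "('i, 'j) cat_data \<Rightarrow> ('o, 'm) cat_data \<Rightarrow> ('i, 'j, 'o, 'm) functor_data \<Rightarrow>
    'o \<Rightarrow> ('i \<Rightarrow> 'm) \<Rightarrow> bool" where
  "is_limit J C D c \<pi> \<longleftrightarrow> is_cone J C D c \<pi> \<and>
     (\<forall>d \<rho>. is_cone J C D d \<rho> \<longrightarrow>
        (\<exists>!h. h \<in> Hom C d c \<and> (\<forall>i \<in> Obj J. Comp C d c (Fob D i) (\<pi> i) h = \<rho> i)))"

text \<open>Every finite category is isomorphic to one whose objects and morphisms are natural numbers.\<close>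

definition has_finite_limits :: "('o, 'm) cat_data \<Rightarrow> bool" where
  "has_finite_limits C \<longleftrightarrow> (\<forall>(J :: (nat, nat) cat_data) D.
     cat_functor J C D \<longrightarrow> finite (Obj J) \<longrightarrow> (\<forall>i \<in> Obj J. \<forall>j \<in> Obj J. finite (Hom J i j)) \<longrightarrow>
     (\<exists>c \<pi>. is_limit J C D c \<pi>))"

definition is_pullback :: "('o, 'm) cat_data \<Rightarrow> 'o \<Rightarrow> 'o \<Rightarrow> 'o \<Rightarrow> 'm \<Rightarrow> 'm \<Rightarrow>
    'o \<Rightarrow> 'm \<Rightarrow> 'm \<Rightarrow> bool" where
  "is_pullback C a b z f g q p1 p2 \<longleftrightarrow>
     q \<in> Obj C \<and> p1 \<in> Hom C q a \<and> p2 \<in> Hom C q b \<and> Comp C q a z f p1 = Comp C q b z g p2 \<and>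
     (\<forall>x \<in> Obj C. \<forall>u \<in> Hom C x a. \<forall>v \<in> Hom C x b. Comp C x a z f u = Comp C x b z g v \<longrightarrow>
        (\<exists>!h. h \<in> Hom C x q \<and> Comp C x q a p1 h = u \<and> Comp C x q b p2 h = v))"

definition is_coproduct :: "('o, 'm) cat_data \<Rightarrow> 'i set \<Rightarrow> ('i \<Rightarrow> 'o) \<Rightarrow> 'o \<Rightarrow> ('i \<Rightarrow> 'm) \<Rightarrow> bool" where
  "is_coproduct C I A c \<iota> \<longleftrightarrow> c \<in> Obj C \<and> (\<forall>i \<in> I. \<iota> i \<in> Hom C (A i) c) \<and>
     (\<forall>d \<in> Obj C. \<forall>g. (\<forall>i \<in> I. g i \<in> Hom C (A i) d) \<longrightarrow>
        (\<exists>!h. h \<in> Hom C c d \<and> (\<forall>i \<in> I. Comp C (A i) c d h (\<iota> i) = g i)))"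

definition coprod :: "('o, 'm) cat_data \<Rightarrow> 'i set \<Rightarrow> ('i \<Rightarrow> 'o) \<Rightarrow> 'o \<times> ('i \<Rightarrow> 'm)" where
  "coprod C I A = (SOME (c, \<iota>). is_coproduct C I A c \<iota>)"

abbreviation coprod_ob :: "('o, 'm) cat_data \<Rightarrow> 'i set \<Rightarrow> ('i \<Rightarrow> 'o) \<Rightarrow> 'o" where
  "coprod_ob C I A \<equiv> fst (coprod C I A)"

abbreviation coprod_in :: "('o, 'm) cat_data \<Rightarrow> 'i set \<Rightarrow> ('i \<Rightarrow> 'o) \<Rightarrow> 'i \<Rightarrow> 'm" where
  "coprod_in C I A \<equiv> snd (coprod C I A)"

definition cotuple :: "('o, 'm) cat_data \<Rightarrow> 'i set \<Rightarrow> ('i \<Rightarrow> 'o) \<Rightarrow> 'o \<Rightarrow> ('i \<Rightarrow> 'm) \<Rightarrow> 'm" where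
  "cotuple C I A d g = (THE h. h \<in> Hom C (coprod_ob C I A) d \<and>
     (\<forall>i \<in> I. Comp C (A i) (coprod_ob C I A) d h (coprod_in C I A i) = g i))"


section \<open>Cartesian monoidal and distributive categories\<close>

record ('o, 'm) cart_data =
  One :: 'o
  Prod :: "'o \<Rightarrow> 'o \<Rightarrow> 'o"
  Pr1 :: "'o \<Rightarrow> 'o \<Rightarrow> 'm"
  Pr2 :: "'o \<Rightarrow> 'o \<Rightarrow> 'm"

locale cartesian_monoidal = category V
  for V :: "('o, 'm) cat_data" +
  fixes K :: "('o, 'm) cart_data"
  assumes One_in_Obj: "One K \<in> Obj V"
    and One_terminal: "a \<in> Obj V \<Longrightarrow> \<exists>!h. h \<in> Hom V a (One K)"
    and Prod_in_Obj: "\<lbrakk>a \<in> Obj V; b \<in> Obj V\<rbrakk> \<Longrightarrow> Prod K a b \<in> Obj V"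
    and Pr1_in_Hom: "\<lbrakk>a \<in> Obj V; b \<in> Obj V\<rbrakk> \<Longrightarrow> Pr1 K a b \<in> Hom V (Prod K a b) a"
    and Pr2_in_Hom: "\<lbrakk>a \<in> Obj V; b \<in> Obj V\<rbrakk> \<Longrightarrow> Pr2 K a b \<in> Hom V (Prod K a b) b"
    and Prod_universal: "\<lbrakk>a \<in> Obj V; b \<in> Obj V; x \<in> Obj V; f \<in> Hom V x a; g \<in> Hom V x b\<rbrakk>
      \<Longrightarrow> \<exists>!h. h \<in> Hom V x (Prod K a b) \<and> Comp V x (Prod K a b) a (Pr1 K a b) h = f \<and>
            Comp V x (Prod K a b) b (Pr2 K a b) h = g"

definition to_one :: "('o, 'm) cat_data \<Rightarrow> ('o, 'm) cart_data \<Rightarrow> 'o \<Rightarrow> 'm" where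
  "to_one V K a = (THE h. h \<in> Hom V a (One K))"

text \<open>\<open>\<langle>f, g\<rangle>: x \<rightarrow> a \<times> b\<close> for \<open>f: x \<rightarrow> a\<close> and \<open>g: x \<rightarrow> b\<close>.\<close>

definition pairing :: "('o, 'm) cat_data \<Rightarrow> ('o, 'm) cart_data \<Rightarrow> 'o \<Rightarrow> 'o \<Rightarrow> 'o \<Rightarrow> 'm \<Rightarrow> 'm \<Rightarrow> 'm" where
  "pairing V K x a b f g = (THE h. h \<in> Hom V x (Prod K a b) \<and>
     Comp V x (Prod K a b) a (Pr1 K a b) h = f \<and> Comp V x (Prod K a b) b (Pr2 K a b) h = g)"

text \<open>\<open>f \<times> g: a \<times> b \<rightarrow> a' \<times> b'\<close> for \<open>f: a \<rightarrow> a'\<close> and \<open>g: b \<rightarrow> b'\<close>.\<close>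

definition prod_map :: "('o, 'm) cat_data \<Rightarrow> ('o, 'm) cart_data \<Rightarrow> 'o \<Rightarrow> 'o \<Rightarrow> 'o \<Rightarrow> 'o \<Rightarrow>
    'm \<Rightarrow> 'm \<Rightarrow> 'm" where
  "prod_map V K a b a' b' f g = pairing V K (Prod K a b) a' b'
     (Comp V (Prod K a b) a a' f (Pr1 K a b)) (Comp V (Prod K a b) b b' g (Pr2 K a b))"

text \<open>The type \<open>'u\<close> plays the role of a universe: the small sets are the sets of elements of \<open>'u\<close> of
  cardinality below that of \<open>'u\<close>. If \<open>'u\<close> is (in bijection with) a Grothendieck universe, that is, its
  cardinality is strongly inaccessible, these are exactly the elements of that universe.\<close>

definition small :: "'u set \<Rightarrow> bool" where
  "small X \<longleftrightarrow> X \<prec> (UNIV :: 'u set)"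

definition locally_small :: "('o, 'u) cat_data \<Rightarrow> bool" where
  "locally_small V \<longleftrightarrow> (\<forall>a \<in> Obj V. \<forall>b \<in> Obj V. small (Hom V a b))"

definition has_small_coproducts :: "('o, 'u) cat_data \<Rightarrow> bool" where
  "has_small_coproducts V \<longleftrightarrow> (\<forall>(I :: 'u set) A. small I \<longrightarrow> (\<forall>i \<in> I. A i \<in> Obj V) \<longrightarrow>
     (\<exists>c \<iota>. is_coproduct V I A c \<iota>))"

definition distributive :: "('o, 'u) cat_data \<Rightarrow> ('o, 'u) cart_data \<Rightarrow> bool" where
  "distributive V K \<longleftrightarrow> has_small_coproducts V \<and>
     (\<forall>(I :: 'u set) A c \<iota>. \<forall>a \<in> Obj V.
        small I \<longrightarrow> (\<forall>i \<in> I. A i \<in> Obj V) \<longrightarrow> is_coproduct V I A c \<iota> \<longrightarrow>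
        is_coproduct V I (\<lambda>i. Prod K a (A i)) (Prod K a c)
          (\<lambda>i. prod_map V K a (A i) a c (Id V a) (\<iota> i)) \<and>
        is_coproduct V I (\<lambda>i. Prod K (A i) a) (Prod K c a)
          (\<lambda>i. prod_map V K (A i) a c a (\<iota> i) (Id V a)))"


section \<open>The graph of spans\<close>

record ('o, 'm) span =
  span_dom :: 'o
  span_cod :: 'o
  apex :: 'o
  left_leg :: 'm
  right_leg :: 'm

record 'm span_mor =
  on_dom :: 'm
  on_apex :: 'm
  on_cod :: 'm

definition span_cat :: "('o, 'm) cat_data \<Rightarrow> (('o, 'm) span, 'm span_mor) cat_data" where
  "span_cat V = \<lparr>
     Obj = {p. span_dom p \<in> Obj V \<and> span_cod p \<in> Obj V \<and> apex p \<in> Obj V \<and>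
       left_leg p \<in> Hom V (apex p) (span_dom p) \<and> right_leg p \<in> Hom V (apex p) (span_cod p)},
     Hom = (\<lambda>p q. {t. on_dom t \<in> Hom V (span_dom p) (span_dom q) \<and>
       on_apex t \<in> Hom V (apex p) (apex q) \<and>
       on_cod t \<in> Hom V (span_cod p) (span_cod q) \<and>
       Comp V (apex p) (apex q) (span_dom q) (left_leg q) (on_apex t)
         = Comp V (apex p) (span_dom p) (span_dom q) (on_dom t) (left_leg p) \<and>
       Comp V (apex p) (apex q) (span_cod q) (right_leg q) (on_apex t)
         = Comp V (apex p) (span_cod p) (span_cod q) (on_cod t) (right_leg p)}),
     Id = (\<lambda>p. \<lparr>on_dom = Id V (span_dom p), on_apex = Id V (apex p), on_cod = Id V (span_cod p)\<rparr>),
     Comp = (\<lambda>p q r t s. \<lparr>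
       on_dom = Comp V (span_dom p) (span_dom q) (span_dom r) (on_dom t) (on_dom s),
       on_apex = Comp V (apex p) (apex q) (apex r) (on_apex t) (on_apex s),
       on_cod = Comp V (span_cod p) (span_cod q) (span_cod r) (on_cod t) (on_cod s)\<rparr>)\<rparr>"

definition span_graph ::
  "('o, 'm) cat_data \<Rightarrow> ('o, 'm, ('o, 'm) span, 'm span_mor) graph_data" where
  "span_graph V = \<lparr>G0 = V, G1 = span_cat V,
     Src = \<lparr>Fob = span_dom, Far = (\<lambda>p q. on_dom)\<rparr>,
     Tgt = \<lparr>Fob = span_cod, Far = (\<lambda>p q. on_cod)\<rparr>\<rparr>"


section \<open>The graph of matrices\<close>

definition set_cat :: "('u set, 'u \<Rightarrow> 'u) cat_data" where
  "set_cat = \<lparr>Obj = {X. small X}, Hom = (\<lambda>X Y. X \<rightarrow>\<^sub>E Y), Id = (\<lambda>X. \<lambda>x\<in>X. x),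
     Comp = (\<lambda>X Y Z g f. compose X g f)\<rparr>"

record ('o, 'u) matrix =
  rows :: "'u set"
  cols :: "'u set"
  entry :: "'u \<times> 'u \<Rightarrow> 'o"

record 'u matrix_mor =
  on_rows :: "'u \<Rightarrow> 'u"
  on_cols :: "'u \<Rightarrow> 'u"
  on_entry :: "'u \<times> 'u \<Rightarrow> 'u"

definition matrix_cat :: "('o, 'u) cat_data \<Rightarrow> (('o, 'u) matrix, 'u matrix_mor) cat_data" where
  "matrix_cat V = \<lparr>
     Obj = {p. small (rows p) \<and> small (cols p) \<and> entry p \<in> rows p \<times> cols p \<rightarrow>\<^sub>E Obj V},
     Hom = (\<lambda>p q. {t. on_rows t \<in> rows p \<rightarrow>\<^sub>E rows q \<and> on_cols t \<in> cols p \<rightarrow>\<^sub>E cols q \<and>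
       on_entry t \<in> (\<Pi>\<^sub>E (x, y) \<in> rows p \<times> cols p.
         Hom V (entry p (x, y)) (entry q (on_rows t x, on_cols t y)))}),
     Id = (\<lambda>p. \<lparr>on_rows = (\<lambda>x\<in>rows p. x), on_cols = (\<lambda>y\<in>cols p. y),
       on_entry = (\<lambda>(x, y)\<in>rows p \<times> cols p. Id V (entry p (x, y)))\<rparr>),
     Comp = (\<lambda>p q r t s. \<lparr>
       on_rows = compose (rows p) (on_rows t) (on_rows s),
       on_cols = compose (cols p) (on_cols t) (on_cols s),
       on_entry = (\<lambda>(x, y)\<in>rows p \<times> cols p.
         Comp V (entry p (x, y)) (entry q (on_rows s x, on_cols s y))
           (entry r (on_rows t (on_rows s x), on_cols t (on_cols s y)))
           (on_entry t (on_rows s x, on_cols s y)) (on_entry s (x, y)))\<rparr>)\<rparr>"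

definition matrix_graph ::
  "('o, 'u) cat_data \<Rightarrow> ('u set, 'u \<Rightarrow> 'u, ('o, 'u) matrix, 'u matrix_mor) graph_data" where
  "matrix_graph V = \<lparr>G0 = set_cat, G1 = matrix_cat V,
     Src = \<lparr>Fob = rows, Far = (\<lambda>p q. on_rows)\<rparr>,
     Tgt = \<lparr>Fob = cols, Far = (\<lambda>p q. on_cols)\<rparr>\<rparr>"


section \<open>The two graph morphisms\<close>

subsection \<open>\<open>- * 1\<close>\<close>

abbreviation copower_ob :: "('o, 'm) cat_data \<Rightarrow> ('o, 'm) cart_data \<Rightarrow> 'i set \<Rightarrow> 'o" where
  "copower_ob V K X \<equiv> coprod_ob V X (\<lambda>_. One K)"

abbreviation copower_in :: "('o, 'm) cat_data \<Rightarrow> ('o, 'm) cart_data \<Rightarrow> 'i set \<Rightarrow> 'i \<Rightarrow> 'm" where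
  "copower_in V K X \<equiv> coprod_in V X (\<lambda>_. One K)"

definition copower :: "('o, 'm) cat_data \<Rightarrow> ('o, 'm) cart_data \<Rightarrow>
    ('i set, 'i \<Rightarrow> 'i, 'o, 'm) functor_data" where
  "copower V K = \<lparr>Fob = copower_ob V K,
     Far = (\<lambda>X Y f. cotuple V X (\<lambda>_. One K) (copower_ob V K Y) (\<lambda>x. copower_in V K Y (f x)))\<rparr>"

text \<open>The map \<open>a \<rightarrow> 1 \<rightarrow> X * 1\<close> whose second factor is the coprojection at \<open>x\<close>.\<close>

definition const_at :: "('o, 'm) cat_data \<Rightarrow> ('o, 'm) cart_data \<Rightarrow> 'i set \<Rightarrow> 'o \<Rightarrow> 'i \<Rightarrow> 'm" where
  "const_at V K X a x = Comp V a (One K) (copower_ob V K X) (copower_in V K X x) (to_one V K a)"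

definition matrix_to_span :: "('o, 'u) cat_data \<Rightarrow> ('o, 'u) cart_data \<Rightarrow>
    (('o, 'u) matrix, 'u matrix_mor, ('o, 'u) span, 'u span_mor) functor_data" where
  "matrix_to_span V K = \<lparr>
     Fob = (\<lambda>p. \<lparr>span_dom = copower_ob V K (rows p), span_cod = copower_ob V K (cols p),
       apex = coprod_ob V (rows p \<times> cols p) (entry p),
       left_leg = cotuple V (rows p \<times> cols p) (entry p) (copower_ob V K (rows p))
         (\<lambda>(x, y). const_at V K (rows p) (entry p (x, y)) x),
       right_leg = cotuple V (rows p \<times> cols p) (entry p) (copower_ob V K (cols p))
         (\<lambda>(x, y). const_at V K (cols p) (entry p (x, y)) y)\<rparr>),
     Far = (\<lambda>p q t. \<lparr>on_dom = Far (copower V K) (rows p) (rows q) (on_rows t),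
       on_apex = cotuple V (rows p \<times> cols p) (entry p) (coprod_ob V (rows q \<times> cols q) (entry q))
         (\<lambda>(x, y). Comp V (entry p (x, y)) (entry q (on_rows t x, on_cols t y))
           (coprod_ob V (rows q \<times> cols q) (entry q))
           (coprod_in V (rows q \<times> cols q) (entry q) (on_rows t x, on_cols t y))
           (on_entry t (x, y))),
       on_cod = Far (copower V K) (cols p) (cols q) (on_cols t)\<rparr>)\<rparr>"

definition copower_graph_mor :: "('o, 'u) cat_data \<Rightarrow> ('o, 'u) cart_data \<Rightarrow>
    ('u set, 'u \<Rightarrow> 'u, ('o, 'u) matrix, 'u matrix_mor,
     'o, 'u, ('o, 'u) span, 'u span_mor) graph_mor" where
  "copower_graph_mor V K = \<lparr>M0 = copower V K, M1 = matrix_to_span V K\<rparr>"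


subsection \<open>\<open>V(1, -)\<close>\<close>

definition points :: "('o, 'm) cat_data \<Rightarrow> ('o, 'm) cart_data \<Rightarrow>
    ('o, 'm, 'm set, 'm \<Rightarrow> 'm) functor_data" where
  "points V K = \<lparr>Fob = (\<lambda>a. Hom V (One K) a),
     Far = (\<lambda>a b f. \<lambda>v\<in>Hom V (One K) a. Comp V (One K) a b f v)\<rparr>"

text \<open>A chosen pullback \<open>(q, q \<rightarrow> M\<^sub>s, q \<rightarrow> 1)\<close> of \<open>\<langle>l\<^sub>s, r\<^sub>s\<rangle>\<close> along \<open>\<langle>v, w\<rangle>\<close>.\<close>

definition span_fibre :: "('o, 'm) cat_data \<Rightarrow> ('o, 'm) cart_data \<Rightarrow> ('o, 'm) span \<Rightarrow>
    'm \<Rightarrow> 'm \<Rightarrow> 'o \<times> 'm \<times> 'm" where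
  "span_fibre V K s v w = (SOME (q, p1, p2).
     is_pullback V (apex s) (One K) (Prod K (span_dom s) (span_cod s))
       (pairing V K (apex s) (span_dom s) (span_cod s) (left_leg s) (right_leg s))
       (pairing V K (One K) (span_dom s) (span_cod s) v w) q p1 p2)"

abbreviation fibre_ob :: "('o, 'm) cat_data \<Rightarrow> ('o, 'm) cart_data \<Rightarrow> ('o, 'm) span \<Rightarrow>
    'm \<Rightarrow> 'm \<Rightarrow> 'o" where
  "fibre_ob V K s v w \<equiv> fst (span_fibre V K s v w)"

abbreviation fibre_pr1 :: "('o, 'm) cat_data \<Rightarrow> ('o, 'm) cart_data \<Rightarrow> ('o, 'm) span \<Rightarrow>
    'm \<Rightarrow> 'm \<Rightarrow> 'm" where
  "fibre_pr1 V K s v w \<equiv> fst (snd (span_fibre V K s v w))"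

abbreviation fibre_pr2 :: "('o, 'm) cat_data \<Rightarrow> ('o, 'm) cart_data \<Rightarrow> ('o, 'm) span \<Rightarrow>
    'm \<Rightarrow> 'm \<Rightarrow> 'm" where
  "fibre_pr2 V K s v w \<equiv> snd (snd (span_fibre V K s v w))"

text \<open>The map from the fibre of \<open>s\<close> at \<open>(v, w)\<close> to the fibre of \<open>s'\<close> at \<open>(v', w')\<close> induced by
  \<open>\<theta>: M\<^sub>s \<rightarrow> M\<^sub>s\<^sub>'\<close> and the identity of \<open>1\<close>.\<close>

definition fibre_map :: "('o, 'm) cat_data \<Rightarrow> ('o, 'm) cart_data \<Rightarrow> ('o, 'm) span \<Rightarrow>
    ('o, 'm) span \<Rightarrow> 'm \<Rightarrow> 'm \<Rightarrow> 'm \<Rightarrow> 'm \<Rightarrow> 'm \<Rightarrow> 'm" where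
  "fibre_map V K s s' v w v' w' \<theta> = (THE h.
     h \<in> Hom V (fibre_ob V K s v w) (fibre_ob V K s' v' w') \<and>
     Comp V (fibre_ob V K s v w) (fibre_ob V K s' v' w') (apex s') (fibre_pr1 V K s' v' w') h
       = Comp V (fibre_ob V K s v w) (apex s) (apex s') \<theta> (fibre_pr1 V K s v w) \<and>
     Comp V (fibre_ob V K s v w) (fibre_ob V K s' v' w') (One K) (fibre_pr2 V K s' v' w') h
       = fibre_pr2 V K s v w)"

definition span_to_matrix :: "('o, 'u) cat_data \<Rightarrow> ('o, 'u) cart_data \<Rightarrow>
    (('o, 'u) span, 'u span_mor, ('o, 'u) matrix, 'u matrix_mor) functor_data" where
  "span_to_matrix V K = \<lparr>
     Fob = (\<lambda>s. \<lparr>rows = Hom V (One K) (span_dom s), cols = Hom V (One K) (span_cod s),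
       entry = (\<lambda>(v, w)\<in>Hom V (One K) (span_dom s) \<times> Hom V (One K) (span_cod s).
         fibre_ob V K s v w)\<rparr>),
     Far = (\<lambda>s s' t. \<lparr>on_rows = Far (points V K) (span_dom s) (span_dom s') (on_dom t),
       on_cols = Far (points V K) (span_cod s) (span_cod s') (on_cod t),
       on_entry = (\<lambda>(v, w)\<in>Hom V (One K) (span_dom s) \<times> Hom V (One K) (span_cod s).
         fibre_map V K s s' v w
           (Comp V (One K) (span_dom s) (span_dom s') (on_dom t) v)
           (Comp V (One K) (span_cod s) (span_cod s') (on_cod t) w) (on_apex t))\<rparr>)\<rparr>"

definition points_graph_mor :: "('o, 'u) cat_data \<Rightarrow> ('o, 'u) cart_data \<Rightarrow>
    ('o, 'u, ('o, 'u) span, 'u span_mor,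
     'u set, 'u \<Rightarrow> 'u, ('o, 'u) matrix, 'u matrix_mor) graph_mor" where
  "points_graph_mor V K = \<lparr>M0 = points V K, M1 = span_to_matrix V K\<rparr>"

end

theory Submission
  imports Defs
begin

text \<open>A matrix morphism from \<open>p: X \<rightarrow> Y\<close> to the matrix of a span \<open>s: a \<rightarrow> b\<close> consists of functions
  \<open>f: X \<rightarrow> V(1, a)\<close>, \<open>g: Y \<rightarrow> V(1, b)\<close> and maps from \<open>p(x, y)\<close> to the fibre of \<open>s\<close> over
  \<open>(f x, g y)\<close>, that is, maps \<open>p(x, y) \<rightarrow> M\<^sub>s\<close> whose composites with the legs are constant at \<open>f x\<close>
  and \<open>g y\<close>. By the universal property of coproducts this is the same as maps \<open>X * 1 \<rightarrow> a\<close>,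
  \<open>Y * 1 \<rightarrow> b\<close> and \<open>\<Sum>p(x, y) \<rightarrow> M\<^sub>s\<close> that commute with the legs. The entries of the unit are the
  factorizations of the coprojections of \<open>\<Sum>p(x, y)\<close> through the fibres, and the counit is the cotuple
  of the projections of the fibres to \<open>M\<^sub>s\<close>. Equations are checked after composition with
  coprojections, which are jointly epic, or with the projection of a fibre to \<open>M\<^sub>s\<close>, which is monic.\<close>

section \<open>Smallness\<close>

text \<open>Size shapes the construction. A matrix is summed over
  \<open>rows p \<times> cols p\<close>, a set of pairs, while the small coproducts of
  \<open>V\<close> are indexed by subsets of \<open>'u\<close>. The sum exists because a product of
  small sets again has cardinality below that of \<open>'u\<close>, for which \<open>'u\<close> is
  assumed infinite, and because a coproduct can be reindexed along a bijection. Conversely, the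
  points of an object become the rows or columns of a matrix, which calls for local smallness.
  Coproducts and fibres are arbitrary choices, so everything rests on their universal properties.
  The fibre over (v, w) is a pullback of a map into a product along a map out of 1: its square
  splits into one equation per leg, and its projection to 1 is forced. This is what turns the
  pullback into the condition of being constant at v and w. Fibres are indexed by points, so two
  maps into fibres can be compared only once their points are known to be equal. This is why the
  arguments about fibres keep establishing equations between images of points.\<close>

lemma small_Times:
  includes cardinal_syntax
  assumes inf: "infinite (UNIV :: 'u set)" and X: "small (X :: 'u set)" and Y: "small (Y :: 'u set)"
  shows "X \<times> Y \<prec> (UNIV :: 'u set)"
proof (cases "finite X \<and> finite Y")
  case True
  then show ?thesis by (simp add: inf finite_lesspoll_infinite)
next
  \<comment> \<open>One of the two sets dominates the other and, as they are not both finite, the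
    dominating one is infinite. An infinite cardinal absorbs the product.\<close>
  case False
  have "|X| \<le>o |Y| \<or> |Y| \<le>o |X|"
    using ordLeq_total card_of_Well_order by blast
  then obtain Z :: "'u set" where Z: "small Z" "infinite Z" "|X| \<le>o |Z|" "|Y| \<le>o |Z|"
  proof
    assume "|X| \<le>o |Y|"
    with False Y show thesis
      using that[of Y] by (auto simp: card_of_refl ordIso_imp_ordLeq dest: card_of_ordLeq_finite)
  next
    assume "|Y| \<le>o |X|"
    with False X show thesis
      using that[of X] by (auto simp: card_of_refl ordIso_imp_ordLeq dest: card_of_ordLeq_finite)
  qed
  then have "|X \<times> Y| \<le>o |Z|"
    using card_of_Times_ordLeq_infinite_Field[of "|Z|" X Y] Field_card_of card_of_Card_order by
        metis
  then have "X \<times> Y \<lesssim> Z"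
    by (simp add: lepoll_def flip: card_of_ordLeq)
  with Z(1) show ?thesis
    unfolding small_def by (rule lesspoll_trans1[rotated])
qed

section \<open>Coproducts and pullbacks\<close>

text \<open>Cocones over the two families correspond by precomposing with
  \<open>inv_into I \<phi>\<close>. This carries coproducts from subsets of \<open>'u\<close> to
  index sets of any type, in particular to sets of pairs.\<close>

lemma is_coproduct_reindex:
  assumes \<phi>: "bij_betw \<phi> I J" and cop: "is_coproduct C J (\<lambda>j. A (inv_into I \<phi> j)) c \<iota>"
  shows "is_coproduct C I A c (\<lambda>i. \<iota> (\<phi> i))"
  unfolding is_coproduct_def
proof (intro conjI ballI allI impI)
  have inv [simp]: "inv_into I \<phi> (\<phi> i) = i" if "i \<in> I" for i
    using \<phi> that by (auto simp: bij_betw_def)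
  have J: "J = \<phi> ` I"
    using \<phi> by (simp add: bij_betw_def)
  show "c \<in> Obj C" using cop by (simp add: is_coproduct_def)
  show "\<iota> (\<phi> i) \<in> Hom C (A i) c" if "i \<in> I" for i
    using cop that by (simp add: is_coproduct_def J)
  fix d g assume d: "d \<in> Obj C" and g: "\<forall>i\<in>I. g i \<in> Hom C (A i) d"
  have "\<forall>j\<in>J. g (inv_into I \<phi> j) \<in> Hom C (A (inv_into I \<phi> j)) d"
    using g by (simp add: J)
  then have "\<exists>!h. h \<in> Hom C c d \<and>
      (\<forall>j\<in>J. Comp C (A (inv_into I \<phi> j)) c d h (\<iota> j) = g (inv_into I \<phi> j))"
    using cop d by (auto simp: is_coproduct_def)
  then show "\<exists>!h. h \<in> Hom C c d \<and> (\<forall>i\<in>I. Comp C (A i) c d h (\<iota> (\<phi> i)) = g i)"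
    by (simp add: J)
qed

text \<open>\<open>has_finite_limits\<close> speaks of shapes made of natural numbers, so the cospan
  0 -> 2 <- 1 is coded there. Each hom-set contains at most the element 0, hence all parallel arrows
  are equal.\<close>

definition cospan_shape :: "(nat, nat) cat_data" where
  "cospan_shape = \<lparr>Obj = {0, 1, 2}, Hom = (\<lambda>i j. if i = j \<or> j = 2 then {0} else {}),
     Id = (\<lambda>i. 0), Comp = (\<lambda>i j k u v. 0)\<rparr>"

lemma cospan_shape_category: "category cospan_shape"
  by (unfold_locales, simp_all add: cospan_shape_def split: if_split_asm) (elim disjE; simp)

definition cospan_diagram :: "('o, 'm) cat_data \<Rightarrow> 'o \<Rightarrow> 'o \<Rightarrow> 'o \<Rightarrow> 'm \<Rightarrow> 'm \<Rightarrow>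
    (nat, nat, 'o, 'm) functor_data" where
  "cospan_diagram C a b z f g = \<lparr>Fob = (\<lambda>i. if i = 0 then a else if i = 1 then b else z),
     Far = (\<lambda>i j u. if i = j then Id C (if i = 0 then a else if i = 1 then b else z)
       else if i = 0 then f else g)\<rparr>"

lemma cospan_diagram_functor:
  assumes "category C" "a \<in> Obj C" "b \<in> Obj C" "z \<in> Obj C" "f \<in> Hom C a z" "g \<in> Hom C b z"
  shows "cat_functor cospan_shape C (cospan_diagram C a b z f g)"
proof -
  interpret category C by fact
  let ?D = "cospan_diagram C a b z f g"
  have ob: "Fob ?D i \<in> Obj C" for i
    using assms by (simp add: cospan_diagram_def)
  have hom: "Far ?D i j u \<in> Hom C (Fob ?D i) (Fob ?D j)"
    if "i \<in> Obj cospan_shape" "u \<in> Hom cospan_shape i j" for i j u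
    using that assms Id_in_Hom
    by (simp add: cospan_diagram_def cospan_shape_def split: if_split_asm) auto
  show ?thesis
  proof (intro cat_functor.intro cat_functor_axioms.intro cospan_shape_category assms(1) ob hom)
    fix i j k u v
    assume *: "i \<in> Obj cospan_shape" "j \<in> Obj cospan_shape" "k \<in> Obj cospan_shape"
      "u \<in> Hom cospan_shape i j" "v \<in> Hom cospan_shape j k"
    note homs = hom[OF *(1,4)] hom[OF *(2,5)]
    \<comment> \<open>Two non-identity arrows of the shape never compose, so functoriality reduces
      to the two unit laws.\<close>
    consider "i = j" | "i \<noteq> j" "j = 2" "k = 2"
      using * by (auto simp: cospan_shape_def split: if_split_asm)
    then show "Far ?D i k (Comp cospan_shape i j k v u)
      = Comp C (Fob ?D i) (Fob ?D j) (Fob ?D k) (Far ?D j k v) (Far ?D i j u)"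
    proof cases
      case 1
      moreover have "Far ?D j k v = Far ?D j k (Comp cospan_shape j j k v u)"
        "Far ?D j j u = Id C (Fob ?D j)"
        by (simp_all add: cospan_diagram_def)
      ultimately show ?thesis
        using homs(2) by (simp add: Comp_Id_right ob)
    next
      case 2
      moreover have "Far ?D i 2 (Comp cospan_shape i 2 2 v u) = Far ?D i 2 u"
        "Far ?D 2 2 v = Id C (Fob ?D 2)"
        by (simp_all add: cospan_diagram_def)
      ultimately show ?thesis
        using homs(1) by (simp add: Comp_Id_left ob)
    qed
  qed (simp_all add: cospan_diagram_def)
qed

text \<open>A cone over a cospan is a commuting square: its leg to the object 2 must be the common
  composite of the other two.\<close>

lemma pullback_exists:
  assumes C: "category C" and lim: "has_finite_limits C"
    and ob: "a \<in> Obj C" "b \<in> Obj C" "z \<in> Obj C" and mor: "f \<in> Hom C a z" "g \<in> Hom C b z"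
  shows "\<exists>q p1 p2. is_pullback C a b z f g q p1 p2"
proof -
  interpret category C by fact
  let ?J = cospan_shape and ?D = "cospan_diagram C a b z f g"
  have "finite (Obj ?J)" "\<forall>i\<in>Obj ?J. \<forall>j\<in>Obj ?J. finite (Hom ?J i j)"
    by (simp_all add: cospan_shape_def)
  with lim cospan_diagram_functor[OF C ob mor] obtain q \<pi> where q: "is_limit ?J C ?D q \<pi>"
    unfolding has_finite_limits_def by blast
  have cone: "is_cone ?J C ?D x \<rho> \<longleftrightarrow> x \<in> Obj C \<and> \<rho> 0 \<in> Hom C x a \<and> \<rho> 1 \<in> Hom C x b \<and>
      \<rho> 2 \<in> Hom C x z \<and> Comp C x a z f (\<rho> 0) = \<rho> 2 \<and> Comp C x b z g (\<rho> 1) = \<rho> 2" for x \<rho>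
    using ob by (auto simp: is_cone_def cospan_shape_def cospan_diagram_def Comp_Id_left)
  have q': "q \<in> Obj C" "\<pi> 0 \<in> Hom C q a" "\<pi> 1 \<in> Hom C q b" "\<pi> 2 \<in> Hom C q z"
      "Comp C q a z f (\<pi> 0) = \<pi> 2" "Comp C q b z g (\<pi> 1) = \<pi> 2"
    using q cone unfolding is_limit_def by blast+
  have "\<exists>!h. h \<in> Hom C x q \<and> Comp C x q a (\<pi> 0) h = u \<and> Comp C x q b (\<pi> 1) h = v"
    if x: "x \<in> Obj C" "u \<in> Hom C x a" "v \<in> Hom C x b" "Comp C x a z f u
        = Comp C x b z g v" for x u v
  proof -
    define \<rho> where "\<rho> i = (if i = 0 then u else if i = 1 then v else Comp C x a z f u)" for i :: nat
    have "is_cone ?J C ?D x \<rho>"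
      unfolding cone using x ob mor by (simp add: \<rho>_def Comp_in_Hom)
    with q have ex1: "\<exists>!h. h \<in> Hom C x q \<and>
        (\<forall>i\<in>Obj ?J. Comp C x q (Fob ?D i) (\<pi> i) h = \<rho> i)"
      unfolding is_limit_def by blast
    \<comment> \<open>The limit demands a third equation, at the object 2; it follows from the one
      at 0 by composing with \<open>f\<close>.\<close>
    have "h \<in> Hom C x q \<and> (\<forall>i\<in>Obj ?J. Comp C x q (Fob ?D i) (\<pi> i) h = \<rho> i) \<longleftrightarrow>
        h \<in> Hom C x q \<and> Comp C x q a (\<pi> 0) h = u \<and> Comp C x q b (\<pi> 1) h = v" for h
      using Comp_assoc[of x q a z h "\<pi> 0" f] x ob mor q'
      by (auto simp: cospan_shape_def cospan_diagram_def \<rho>_def)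
    with ex1 show ?thesis by simp
  qed
  with q' have "is_pullback C a b z f g q (\<pi> 0) (\<pi> 1)"
    unfolding is_pullback_def by simp
  then show ?thesis by blast
qed

section \<open>Composition of graph morphisms\<close>

lemma functor_id_functor: "category A \<Longrightarrow> cat_functor A A functor_id"
  by (simp add: cat_functor_def cat_functor_axioms_def functor_id_def)

lemma functor_comp_functor:
  assumes "cat_functor A B F" "cat_functor B C G"
  shows "cat_functor A C (functor_comp G F)"
proof -
  interpret F: cat_functor A B F by fact
  interpret G: cat_functor B C G by fact
  show ?thesis
    by unfold_locales (simp_all add: functor_comp_def F.Fob_in_Obj F.Far_in_Hom F.Far_Id F.Far_Comp
        G.Fob_in_Obj G.Far_in_Hom G.Far_Id G.Far_Comp)
qed

lemma graph_mor_id_morphism: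
  assumes "cat_graph G"
  shows "graph_morphism G G graph_mor_id"
proof -
  interpret cat_graph G by fact
  have cats: "category (G0 G)" "category (G1 G)"
    using Src_functor by (simp_all add: cat_functor_def)
  show ?thesis
  proof (intro graph_morphism.intro graph_morphism_axioms.intro cat_graph_axioms)
    show "cat_functor (G0 G) (G0 G) (M0 graph_mor_id)" "cat_functor (G1 G) (G1 G) (M1 graph_mor_id)"
      by (simp_all add: graph_mor_id_def functor_id_functor cats)
  qed (simp_all add: graph_mor_id_def functor_eq_def functor_comp_def functor_id_def)
qed

lemma graph_mor_comp_morphism:
  assumes "graph_morphism G H F" "graph_morphism H K E"
  shows "graph_morphism G K (graph_mor_comp E F)"
proof -
  interpret F: graph_morphism G H F by fact
  interpret E: graph_morphism H K E by fact
  interpret M1: cat_functor "G1 G" "G1 H" "M1 F" by (rule F.M1_functor)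
  show ?thesis
  proof (intro graph_morphism.intro graph_morphism_axioms.intro F.G.cat_graph_axioms
      E.H.cat_graph_axioms)
    show "cat_functor (G0 G) (G0 K) (M0 (graph_mor_comp E F))"
      using functor_comp_functor[OF F.M0_functor E.M0_functor] by (simp add: graph_mor_comp_def)
    show "cat_functor (G1 G) (G1 K) (M1 (graph_mor_comp E F))"
      using functor_comp_functor[OF F.M1_functor E.M1_functor] by (simp add: graph_mor_comp_def)
  \<comment> \<open>The equations for \<open>E\<close> hold only on the carrier of
    \<open>G1 H\<close>, so \<open>M1 F\<close> must be known to land there.\<close>
  qed (use F.Src_commutes F.Tgt_commutes E.Src_commutes E.Tgt_commutes in
      \<open>simp_all add: graph_mor_comp_def functor_eq_def functor_comp_def M1.Fob_in_Obj
          M1.Far_in_Hom\<close>)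
qed

section \<open>The categories of sets, matrices and spans\<close>

lemma set_cat_category: "category set_cat"
proof
qed (auto simp: set_cat_def compose_def PiE_iff extensional_def fun_eq_iff)

lemma span_cat_category:
  assumes "category V"
  shows "category (span_cat V)"
proof -
  interpret category V by fact
  \<comment> \<open>Pasting of two commuting squares along the leg \<open>i\<close>, applied once to
    the left legs and once to the right legs.\<close>
  have square: "Comp V a b z k (Comp V a m b \<theta>' \<theta>) = Comp V a x z (Comp V x y z g f) l"
    if "a \<in> Obj V" "m \<in> Obj V" "b \<in> Obj V" "x \<in> Obj V" "y \<in> Obj V" "z \<in> Obj V"
      "\<theta> \<in> Hom V a m" "\<theta>' \<in> Hom V m b" "f \<in> Hom V x y" "g \<in> Hom V y z"
      "l \<in> Hom V a x" "i \<in> Hom V m y" "k \<in> Hom V b z"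
      "Comp V a m y i \<theta> = Comp V a x y f l" "Comp V m b z k \<theta>' = Comp V m y z g i"
    for a m b x y z \<theta> \<theta>' f g l i k
    by (metis Comp_assoc that)
  show ?thesis
  proof
    fix p q r s t
    assume "p \<in> Obj (span_cat V)" "q \<in> Obj (span_cat V)" "r \<in> Obj (span_cat V)"
      "s \<in> Hom (span_cat V) p q" "t \<in> Hom (span_cat V) q r"
    then show "Comp (span_cat V) p q r t s \<in> Hom (span_cat V) p r"
      by (auto simp: span_cat_def Comp_in_Hom intro: square)
  qed (auto simp: span_cat_def Id_in_Hom Comp_Id_left Comp_Id_right Comp_assoc)
qed

lemma matrix_obj_iff:
  "p \<in> Obj (matrix_cat V) \<longleftrightarrow>
    small (rows p) \<and> small (cols p) \<and> entry p \<in> rows p \<times> cols p \<rightarrow>\<^sub>E Obj V"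
  by (simp add: matrix_cat_def)

lemma matrix_hom_iff:
  "t \<in> Hom (matrix_cat V) p q \<longleftrightarrow>
    on_rows t \<in> rows p \<rightarrow>\<^sub>E rows q \<and> on_cols t \<in> cols p \<rightarrow>\<^sub>E cols q \<and>
    on_entry t \<in> extensional (rows p \<times> cols p) \<and>
    (\<forall>x \<in> rows p. \<forall>y \<in> cols p.
      on_entry t (x, y) \<in> Hom V (entry p (x, y)) (entry q (on_rows t x, on_cols t y)))"
  by (auto simp: matrix_cat_def PiE_def Pi_def)

text \<open>All three components are extensional, that is, fixed outside their index sets, so
  agreement on the index sets suffices. Equations between matrix morphisms are reduced to entries by
  this rule.\<close>

lemma matrix_hom_eqI:
  assumes s: "s \<in> Hom (matrix_cat V) p q" and t: "t \<in> Hom (matrix_cat V) p q"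
    and "\<And>x. x \<in> rows p \<Longrightarrow> on_rows s x = on_rows t x"
    and "\<And>y. y \<in> cols p \<Longrightarrow> on_cols s y = on_cols t y"
    and "\<And>x y. x \<in> rows p \<Longrightarrow> y \<in> cols p \<Longrightarrow> on_entry s (x, y) = on_entry t (x, y)"
  shows "s = t"
proof (rule matrix_mor.equality)
  show "on_rows s = on_rows t" "on_cols s = on_cols t"
    using assms(1-4) unfolding matrix_hom_iff by (blast intro: PiE_ext)+
  show "on_entry s = on_entry t"
    using assms unfolding matrix_hom_iff by (intro extensionalityI[of _ "rows p \<times> cols p"]) auto
qed simp

lemma matrix_id_simps:
  "on_rows (Id (matrix_cat V) p) = (\<lambda>x\<in>rows p. x)"
  "on_cols (Id (matrix_cat V) p) = (\<lambda>y\<in>cols p. y)"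
  "on_entry (Id (matrix_cat V) p) = (\<lambda>(x, y)\<in>rows p \<times> cols p. Id V (entry p (x, y)))"
  by (simp_all add: matrix_cat_def)

lemma matrix_comp_simps:
  "on_rows (Comp (matrix_cat V) p q r t s) = compose (rows p) (on_rows t) (on_rows s)"
  "on_cols (Comp (matrix_cat V) p q r t s) = compose (cols p) (on_cols t) (on_cols s)"
  "on_entry (Comp (matrix_cat V) p q r t s) = (\<lambda>(x, y)\<in>rows p \<times> cols p.
     Comp V (entry p (x, y)) (entry q (on_rows s x, on_cols s y))
       (entry r (on_rows t (on_rows s x), on_cols t (on_cols s y)))
       (on_entry t (on_rows s x, on_cols s y)) (on_entry s (x, y)))"
  by (simp_all add: matrix_cat_def)

lemma matrix_cat_category:
  assumes "category V"
  shows "category (matrix_cat V)"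
proof -
  interpret category V by fact
  have ob: "entry p (x, y) \<in> Obj V"
    if "p \<in> Obj (matrix_cat V)" "x \<in> rows p" "y \<in> cols p" for p x y
    using that by (auto simp: matrix_obj_iff)
  have hom: "x \<in> rows p \<Longrightarrow> on_rows t x \<in> rows q" "y \<in> cols p \<Longrightarrow> on_cols t y \<in> cols q"
      "x \<in> rows p \<Longrightarrow> y \<in> cols p \<Longrightarrow>
        on_entry t (x, y) \<in> Hom V (entry p (x, y)) (entry q (on_rows t x, on_cols t y))"
    if "t \<in> Hom (matrix_cat V) p q" for p q t x y
    using that by (auto simp: matrix_hom_iff)
  have id: "Id (matrix_cat V) p \<in> Hom (matrix_cat V) p p" if "p \<in> Obj (matrix_cat V)" for p
    using ob[OF that] by (auto simp: matrix_hom_iff matrix_id_simps Id_in_Hom)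
  have comp: "Comp (matrix_cat V) p q r t s \<in> Hom (matrix_cat V) p r"
    if "p \<in> Obj (matrix_cat V)" "q \<in> Obj (matrix_cat V)" "r \<in> Obj (matrix_cat V)"
      "s \<in> Hom (matrix_cat V) p q" "t \<in> Hom (matrix_cat V) q r" for p q r s t
  proof -
    have "compose (rows p) (on_rows t) (on_rows s) \<in> rows p \<rightarrow>\<^sub>E rows r"
      "compose (cols p) (on_cols t) (on_cols s) \<in> cols p \<rightarrow>\<^sub>E cols r"
      using that(4,5) by (auto simp: matrix_hom_iff compose_def)
    then show ?thesis
      unfolding matrix_hom_iff
      by (simp add: matrix_comp_simps compose_eq Comp_in_Hom ob hom[OF that(4)] hom[OF that(5)]
          that(1-3))
  qed
  show ?thesis
  proof (unfold_locales, goal_cases)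
    case (1 p)
    then show ?case by (rule id)
  next
    case (2 p q r s t)
    then show ?case by (rule comp)
  next
    case (3 p q s)
    show ?case
      by (rule matrix_hom_eqI[OF comp[OF 3(1,1,2) id[OF 3(1)] 3(3)] 3(3)])
        (simp_all add: matrix_id_simps matrix_comp_simps compose_eq ob hom[OF 3(3)] 3(1,2)
          Comp_Id_right)
  next
    case (4 p q s)
    show ?case
      by (rule matrix_hom_eqI[OF comp[OF 4(1,2,2,3) id[OF 4(2)]] 4(3)])
        (simp_all add: matrix_id_simps matrix_comp_simps compose_eq ob hom[OF 4(3)] 4(1,2)
          Comp_Id_left)
  next
    case (5 p q r s t u v)
    show ?case
      by (rule matrix_hom_eqI[OF comp[OF 5(1,3,4) comp[OF 5(1,2,3,5,6)] 5(7)]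
            comp[OF 5(1,2,4,5) comp[OF 5(2,3,4,6,7)]]])
        (simp_all add: matrix_comp_simps compose_eq ob hom[OF 5(5)] hom[OF 5(6)] hom[OF 5(7)]
          5(1-4) Comp_assoc)
  qed
qed

lemma span_obj_iff:
  "s \<in> Obj (span_cat V) \<longleftrightarrow> span_dom s \<in> Obj V \<and> span_cod s \<in> Obj V \<and> apex s \<in> Obj V \<and>
    left_leg s \<in> Hom V (apex s) (span_dom s) \<and> right_leg s \<in> Hom V (apex s) (span_cod s)"
  by (simp add: span_cat_def)

lemma span_hom_iff:
  "t \<in> Hom (span_cat V) p q \<longleftrightarrow> on_dom t \<in> Hom V (span_dom p) (span_dom q) \<and>
    on_apex t \<in> Hom V (apex p) (apex q) \<and> on_cod t \<in> Hom V (span_cod p) (span_cod q) \<and>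
    Comp V (apex p) (apex q) (span_dom q) (left_leg q) (on_apex t)
      = Comp V (apex p) (span_dom p) (span_dom q) (on_dom t) (left_leg p) \<and>
    Comp V (apex p) (apex q) (span_cod q) (right_leg q) (on_apex t)
      = Comp V (apex p) (span_cod p) (span_cod q) (on_cod t) (right_leg p)"
  by (simp add: span_cat_def)

lemma span_id_simps:
  "on_dom (Id (span_cat V) p) = Id V (span_dom p)"
  "on_apex (Id (span_cat V) p) = Id V (apex p)"
  "on_cod (Id (span_cat V) p) = Id V (span_cod p)"
  by (simp_all add: span_cat_def)

lemma span_comp_simps:
  "on_dom (Comp (span_cat V) p q r t s)
    = Comp V (span_dom p) (span_dom q) (span_dom r) (on_dom t) (on_dom s)"
  "on_apex (Comp (span_cat V) p q r t s) = Comp V (apex p) (apex q) (apex r) (on_apex t)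
    (on_apex s)"
  "on_cod (Comp (span_cat V) p q r t s)
    = Comp V (span_cod p) (span_cod q) (span_cod r) (on_cod t) (on_cod s)"
  by (simp_all add: span_cat_def)

section \<open>Copowers, sums of matrices and fibres of spans\<close>

abbreviation msum :: "('o, 'u) cat_data \<Rightarrow> ('o, 'u) matrix \<Rightarrow> 'o" where
  "msum V p \<equiv> coprod_ob V (rows p \<times> cols p) (entry p)"

abbreviation msum_in :: "('o, 'u) cat_data \<Rightarrow> ('o, 'u) matrix \<Rightarrow> 'u \<times> 'u \<Rightarrow> 'u" where
  "msum_in V p \<equiv> coprod_in V (rows p \<times> cols p) (entry p)"

text \<open>The map a -> 1 -> b constant at the point v of b. \<open>const_at\<close> is the case
  where v is a coprojection of a copower.\<close>

abbreviation konst :: "('o, 'm) cat_data \<Rightarrow> ('o, 'm) cart_data \<Rightarrow> 'o \<Rightarrow> 'o \<Rightarrow> 'm \<Rightarrow> 'm" where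
  "konst V K a b v \<equiv> Comp V a (One K) b v (to_one V K a)"

abbreviation pts :: "('o, 'm) cat_data \<Rightarrow> ('o, 'm) cart_data \<Rightarrow> 'o \<Rightarrow> 'm set" where
  "pts V K a \<equiv> Hom V (One K) a"

text \<open>An infinite universe keeps products of small index sets small, local smallness makes
  V(1, a) an object of \<open>set_cat\<close>, finite limits give the fibres of spans, and small
  coproducts give copowers and sums of matrices.\<close>

locale matrix_span = cartesian_monoidal V K
  for V :: "('o, 'u) cat_data" and K :: "('o, 'u) cart_data" +
  assumes infinite_universe: "infinite (UNIV :: 'u set)"
    and locally_small: "locally_small V"
    and finite_limits: "has_finite_limits V"
    and small_coproducts: "has_small_coproducts V"
begin

text \<open>The index type is arbitrary, so that sums over pairs are covered: an injection of
  \<open>I\<close> into \<open>'u\<close> gives a small set, whose coproduct is transported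
  back.\<close>

lemma coprod_is_coproduct:
  assumes I: "I \<prec> (UNIV :: 'u set)" and A: "\<And>i. i \<in> I \<Longrightarrow> A i \<in> Obj V"
  shows "is_coproduct V I A (coprod_ob V I A) (coprod_in V I A)"
proof -
  obtain \<phi> :: "_ \<Rightarrow> 'u" where \<phi>: "inj_on \<phi> I"
    using I by (auto simp: lesspoll_def lepoll_def)
  then have "small (\<phi> ` I)"
    using I by (simp add: small_def)
  moreover have "\<forall>j \<in> \<phi> ` I. A (inv_into I \<phi> j) \<in> Obj V"
    using \<phi> A by simp
  ultimately obtain c \<iota> where "is_coproduct V (\<phi> ` I) (\<lambda>j. A (inv_into I \<phi> j)) c \<iota>"
    using small_coproducts[unfolded has_small_coproducts_def, rule_format,
        of "\<phi> ` I" "\<lambda>j. A (inv_into I \<phi> j)"]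
    by auto
  then have "is_coproduct V I A c (\<lambda>i. \<iota> (\<phi> i))"
    by (rule is_coproduct_reindex[OF inj_on_imp_bij_betw[OF \<phi>]])
  \<comment> \<open>\<open>coprod\<close> chooses a pair, hence the uncurried form of the
    predicate.\<close>
  then have "case_prod (is_coproduct V I A) (c, \<lambda>i. \<iota> (\<phi> i))"
    by simp
  then have "case_prod (is_coproduct V I A) (coprod V I A)"
    unfolding coprod_def by (rule someI)
  then show ?thesis
    by (simp add: case_prod_beta)
qed

lemma
  assumes "I \<prec> (UNIV :: 'u set)" "\<And>i. i \<in> I \<Longrightarrow> A i \<in> Obj V"
  shows coprod_ob_in_Obj: "coprod_ob V I A \<in> Obj V"
    and coprod_in_in_Hom: "i \<in> I \<Longrightarrow> coprod_in V I A i \<in> Hom V (A i) (coprod_ob V I A)"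
  using coprod_is_coproduct[of I A] assms by (simp_all add: is_coproduct_def)

lemma cotuple_ex1:
  assumes "I \<prec> (UNIV :: 'u set)" "\<And>i. i \<in> I \<Longrightarrow> A i \<in> Obj V"
    and "d \<in> Obj V" "\<And>i. i \<in> I \<Longrightarrow> g i \<in> Hom V (A i) d"
  shows "\<exists>!h. h \<in> Hom V (coprod_ob V I A) d \<and>
    (\<forall>i\<in>I. Comp V (A i) (coprod_ob V I A) d h (coprod_in V I A i) = g i)"
  using coprod_is_coproduct[of I A] assms by (simp add: is_coproduct_def)

lemma
  assumes "I \<prec> (UNIV :: 'u set)" "\<And>i. i \<in> I \<Longrightarrow> A i \<in> Obj V"
    and "d \<in> Obj V" "\<And>i. i \<in> I \<Longrightarrow> g i \<in> Hom V (A i) d"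
  shows cotuple_in_Hom: "cotuple V I A d g \<in> Hom V (coprod_ob V I A) d"
    and cotuple_in: "i \<in> I \<Longrightarrow>
      Comp V (A i) (coprod_ob V I A) d (cotuple V I A d g) (coprod_in V I A i) = g i"
  using theI'[OF cotuple_ex1[of I A d g]] assms by (simp_all add: cotuple_def)

text \<open>Both maps mediate the cocone that \<open>k\<close> induces on the summands, so
  uniqueness identifies them.\<close>

lemma coprod_eqI:
  assumes I: "I \<prec> (UNIV :: 'u set)" and A: "\<And>i. i \<in> I \<Longrightarrow> A i \<in> Obj V" and d: "d \<in> Obj V"
    and h: "h \<in> Hom V (coprod_ob V I A) d" and k: "k \<in> Hom V (coprod_ob V I A) d"
    and eq: "\<And>i. i \<in> I \<Longrightarrow> Comp V (A i) (coprod_ob V I A) d h (coprod_in V I A i)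
      = Comp V (A i) (coprod_ob V I A) d k (coprod_in V I A i)"
  shows "h = k"
proof -
  have "\<exists>!h. h \<in> Hom V (coprod_ob V I A) d \<and>
      (\<forall>i\<in>I. Comp V (A i) (coprod_ob V I A) d h (coprod_in V I A i)
        = Comp V (A i) (coprod_ob V I A) d k (coprod_in V I A i))"
    by (rule cotuple_ex1[OF I A d]) (simp_all add: Comp_in_Hom coprod_ob_in_Obj coprod_in_in_Hom I
        A d k)
  then obtain m where "\<And>l. l \<in> Hom V (coprod_ob V I A) d \<Longrightarrow>
      \<forall>i\<in>I. Comp V (A i) (coprod_ob V I A) d l (coprod_in V I A i)
        = Comp V (A i) (coprod_ob V I A) d k (coprod_in V I A i) \<Longrightarrow> l = m"
    by auto
  from this[OF h] this[OF k] eq show ?thesis by simp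
qed

section \<open>Constant maps and pairings\<close>

lemma to_one_in_Hom: "a \<in> Obj V \<Longrightarrow> to_one V K a \<in> Hom V a (One K)"
  unfolding to_one_def by (rule theI'[OF One_terminal])

lemma to_one_unique: "a \<in> Obj V \<Longrightarrow> h \<in> Hom V a (One K) \<Longrightarrow> h = to_one V K a"
  using One_terminal to_one_in_Hom by blast

lemma konst_in_Hom: "a \<in> Obj V \<Longrightarrow> b \<in> Obj V \<Longrightarrow> v \<in> pts V K b \<Longrightarrow> konst V K a b v \<in> Hom V a b"
  by (simp add: Comp_in_Hom One_in_Obj to_one_in_Hom)

text \<open>By terminality, precomposition changes the source of a constant map but not its
  point.\<close>

lemma konst_precomp:
  assumes "a \<in> Obj V" "b \<in> Obj V" "c \<in> Obj V" "v \<in> pts V K c" "f \<in> Hom V a b"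
  shows "Comp V a b c (konst V K b c v) f = konst V K a c v"
  using assms to_one_unique[of a "Comp V a b (One K) (to_one V K b) f"]
  by (simp add: Comp_assoc[symmetric] Comp_in_Hom One_in_Obj to_one_in_Hom)

text \<open>Postcomposition instead moves the point along \<open>f\<close>. Together with
  \<open>konst_precomp\<close> this evaluates every composite that involves a constant map.\<close>

lemma konst_postcomp:
  assumes "a \<in> Obj V" "b \<in> Obj V" "c \<in> Obj V" "v \<in> pts V K b" "f \<in> Hom V b c"
  shows "Comp V a b c f (konst V K a b v) = konst V K a c (Comp V (One K) b c f v)"
  using assms by (simp add: Comp_assoc One_in_Obj to_one_in_Hom)

lemma
  assumes "a \<in> Obj V" "b \<in> Obj V" "x \<in> Obj V" "f \<in> Hom V x a" "g \<in> Hom V x b"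
  shows pairing_in_Hom: "pairing V K x a b f g \<in> Hom V x (Prod K a b)"
    and Pr1_pairing: "Comp V x (Prod K a b) a (Pr1 K a b) (pairing V K x a b f g) = f"
    and Pr2_pairing: "Comp V x (Prod K a b) b (Pr2 K a b) (pairing V K x a b f g) = g"
  using theI'[OF Prod_universal[OF assms]] by (simp_all add: pairing_def)

lemma pairing_precomp:
  assumes "a \<in> Obj V" "b \<in> Obj V" "x \<in> Obj V" "y \<in> Obj V" "f \<in> Hom V x a" "g \<in> Hom V x b"
    and "k \<in> Hom V y x"
  shows "Comp V y x (Prod K a b) (pairing V K x a b f g) k
    = pairing V K y a b (Comp V y x a f k) (Comp V y x b g k)"
proof -
  let ?l = "Comp V y x (Prod K a b) (pairing V K x a b f g) k"
  have "?l \<in> Hom V y (Prod K a b)" "Comp V y (Prod K a b) a (Pr1 K a b) ?l = Comp V y x a f k"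
    "Comp V y (Prod K a b) b (Pr2 K a b) ?l = Comp V y x b g k"
    using assms
    by (simp_all add: Comp_assoc Comp_in_Hom Prod_in_Obj pairing_in_Hom Pr1_in_Hom Pr2_in_Hom
        Pr1_pairing Pr2_pairing)
  with Prod_universal[of a b y "Comp V y x a f k" "Comp V y x b g k"] assms show ?thesis
    unfolding pairing_def[of V K y] by (intro the1_equality[symmetric]) (simp_all add: Comp_in_Hom)
qed

lemma pairing_eq_iff:
  assumes "a \<in> Obj V" "b \<in> Obj V" "x \<in> Obj V" "f \<in> Hom V x a" "g \<in> Hom V x b"
    and "f' \<in> Hom V x a" "g' \<in> Hom V x b"
  shows "pairing V K x a b f g = pairing V K x a b f' g' \<longleftrightarrow> f = f' \<and> g = g'"
  using Pr1_pairing Pr2_pairing assms by metis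

section \<open>Fibres of spans over pairs of points\<close>

lemma span_fibre_pullback:
  assumes s: "s \<in> Obj (span_cat V)" and v: "v \<in> pts V K (span_dom s)"
    and w: "w \<in> pts V K (span_cod s)"
  shows "is_pullback V (apex s) (One K) (Prod K (span_dom s) (span_cod s))
    (pairing V K (apex s) (span_dom s) (span_cod s) (left_leg s) (right_leg s))
    (pairing V K (One K) (span_dom s) (span_cod s) v w)
    (fibre_ob V K s v w) (fibre_pr1 V K s v w) (fibre_pr2 V K s v w)"
proof -
  let ?P = "is_pullback V (apex s) (One K) (Prod K (span_dom s) (span_cod s))
    (pairing V K (apex s) (span_dom s) (span_cod s) (left_leg s) (right_leg s))
    (pairing V K (One K) (span_dom s) (span_cod s) v w)"
  have "\<exists>q p1 p2. ?P q p1 p2"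
    using s v w by (intro pullback_exists category_axioms finite_limits)
      (simp_all add: span_obj_iff One_in_Obj Prod_in_Obj pairing_in_Hom)
  then obtain q p1 p2 where "?P q p1 p2" by blast
  then have "case (q, p1, p2) of (q, p1, p2) \<Rightarrow> ?P q p1 p2" by simp
  then have "case span_fibre V K s v w of (q, p1, p2) \<Rightarrow> ?P q p1 p2"
    unfolding span_fibre_def by (rule someI)
  then show ?thesis
    by (simp add: case_prod_beta)
qed

text \<open>A map into a product is determined by its components and a map into 1 by its source. The
  pullback square of \<langle>l, r\<rangle> along \<langle>v, w\<rangle> thus amounts to two
  equations between composites with the legs and constant maps, and \<open>fibre_pr1\<close> is
  universal among the maps to the apex that satisfy them.\<close>

lemma
  assumes s: "s \<in> Obj (span_cat V)" and v: "v \<in> pts V K (span_dom s)"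
    and w: "w \<in> pts V K (span_cod s)"
  shows fibre_ob_in_Obj: "fibre_ob V K s v w \<in> Obj V"
    and fibre_pr1_in_Hom: "fibre_pr1 V K s v w \<in> Hom V (fibre_ob V K s v w) (apex s)"
    and left_leg_fibre_pr1: "Comp V (fibre_ob V K s v w) (apex s) (span_dom s) (left_leg s)
      (fibre_pr1 V K s v w) = konst V K (fibre_ob V K s v w) (span_dom s) v"
    and right_leg_fibre_pr1: "Comp V (fibre_ob V K s v w) (apex s) (span_cod s) (right_leg s)
      (fibre_pr1 V K s v w) = konst V K (fibre_ob V K s v w) (span_cod s) w"
    and fibre_pr2_eq: "fibre_pr2 V K s v w = to_one V K (fibre_ob V K s v w)"
    and fibre_ex1: "\<lbrakk>a \<in> Obj V; u \<in> Hom V a (apex s);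
        Comp V a (apex s) (span_dom s) (left_leg s) u = konst V K a (span_dom s) v;
        Comp V a (apex s) (span_cod s) (right_leg s) u = konst V K a (span_cod s) w\<rbrakk> \<Longrightarrow>
      \<exists>!h. h \<in> Hom V a (fibre_ob V K s v w) \<and>
        Comp V a (fibre_ob V K s v w) (apex s) (fibre_pr1 V K s v w) h = u"
proof -
  let ?q = "fibre_ob V K s v w" and ?p1 = "fibre_pr1 V K s v w" and ?p2 = "fibre_pr2 V K s v w"
  note P = span_fibre_pullback[OF assms, unfolded is_pullback_def]
  have S: "span_dom s \<in> Obj V" "span_cod s \<in> Obj V" "apex s \<in> Obj V"
    "left_leg s \<in> Hom V (apex s) (span_dom s)" "right_leg s \<in> Hom V (apex s) (span_cod s)"
    using s by (simp_all add: span_obj_iff)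
  show q: "?q \<in> Obj V" and p1: "?p1 \<in> Hom V ?q (apex s)"
    using P by simp_all
  show p2: "?p2 = to_one V K ?q"
    using P by (simp add: to_one_unique)
  \<comment> \<open>Precomposing the pairings and comparing components turns the single square over
    the product into one equation per leg.\<close>
  have eq: "Comp V a (apex s) (Prod K (span_dom s) (span_cod s))
      (pairing V K (apex s) (span_dom s) (span_cod s) (left_leg s) (right_leg s)) u
      = Comp V a (One K) (Prod K (span_dom s) (span_cod s))
        (pairing V K (One K) (span_dom s) (span_cod s) v w) (to_one V K a) \<longleftrightarrow>
      Comp V a (apex s) (span_dom s) (left_leg s) u = konst V K a (span_dom s) v \<and>
      Comp V a (apex s) (span_cod s) (right_leg s) u = konst V K a (span_cod s) w"
    if "a \<in> Obj V" "u \<in> Hom V a (apex s)" for a u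
    using that S v w
    by (simp add: pairing_precomp pairing_eq_iff One_in_Obj to_one_in_Hom Comp_in_Hom)
  show "Comp V ?q (apex s) (span_dom s) (left_leg s) ?p1 = konst V K ?q (span_dom s) v"
    "Comp V ?q (apex s) (span_cod s) (right_leg s) ?p1 = konst V K ?q (span_cod s) w"
    using P eq[OF q p1] p2 by simp_all
  assume a: "a \<in> Obj V" and u: "u \<in> Hom V a (apex s)"
    and lr: "Comp V a (apex s) (span_dom s) (left_leg s) u = konst V K a (span_dom s) v"
      "Comp V a (apex s) (span_cod s) (right_leg s) u = konst V K a (span_cod s) w"
  have ex1: "\<exists>!h. h \<in> Hom V a ?q \<and> Comp V a ?q (apex s) ?p1 h = u \<and>
      Comp V a ?q (One K) ?p2 h = to_one V K a"
    using P a u eq[OF a u] lr to_one_in_Hom[OF a] by simp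
  \<comment> \<open>The last equation compares two maps into 1, so it holds for every
    \<open>h\<close>.\<close>
  have "h \<in> Hom V a ?q \<and> Comp V a ?q (apex s) ?p1 h = u \<and> Comp V a ?q (One K) ?p2 h = to_one V K a
      \<longleftrightarrow> h \<in> Hom V a ?q \<and> Comp V a ?q (apex s) ?p1 h = u" for h
    using to_one_unique[OF a] p2 a q One_in_Obj to_one_in_Hom Comp_in_Hom by metis
  with ex1 show "\<exists>!h. h \<in> Hom V a ?q \<and> Comp V a ?q (apex s) ?p1 h = u"
    by simp
qed

text \<open>The composite of \<open>k\<close> with the projection again has constant composites with
  the legs, because constants survive precomposition. Hence it factors uniquely through the fibre,
  and \<open>h\<close> and \<open>k\<close> are two such factorizations.\<close>

lemma fibre_eqI:
  assumes s: "s \<in> Obj (span_cat V)" and v: "v \<in> pts V K (span_dom s)"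
    and w: "w \<in> pts V K (span_cod s)"
    and a: "a \<in> Obj V"
    and h: "h \<in> Hom V a (fibre_ob V K s v w)" and k: "k \<in> Hom V a (fibre_ob V K s v w)"
    and eq: "Comp V a (fibre_ob V K s v w) (apex s) (fibre_pr1 V K s v w) h
      = Comp V a (fibre_ob V K s v w) (apex s) (fibre_pr1 V K s v w) k"
  shows "h = k"
proof -
  have S: "span_dom s \<in> Obj V" "span_cod s \<in> Obj V" "apex s \<in> Obj V"
    "left_leg s \<in> Hom V (apex s) (span_dom s)" "right_leg s \<in> Hom V (apex s) (span_cod s)"
    using s by (simp_all add: span_obj_iff)
  note F = fibre_ob_in_Obj[OF s v w] fibre_pr1_in_Hom[OF s v w] left_leg_fibre_pr1[OF s v w]
    right_leg_fibre_pr1[OF s v w]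
  have "\<exists>!h. h \<in> Hom V a (fibre_ob V K s v w) \<and>
      Comp V a (fibre_ob V K s v w) (apex s) (fibre_pr1 V K s v w) h
        = Comp V a (fibre_ob V K s v w) (apex s) (fibre_pr1 V K s v w) k"
    using S F a k v w by (intro fibre_ex1[OF s v w])
        (simp_all add: Comp_in_Hom Comp_assoc konst_precomp)
  with h k eq show ?thesis by blast
qed

definition fibre_lift :: "('o, 'u) span \<Rightarrow> 'u \<Rightarrow> 'u \<Rightarrow> 'o \<Rightarrow> 'u \<Rightarrow> 'u" where
  "fibre_lift s v w a u = (THE h. h \<in> Hom V a (fibre_ob V K s v w) \<and>
    Comp V a (fibre_ob V K s v w) (apex s) (fibre_pr1 V K s v w) h = u)"

lemma
  assumes "s \<in> Obj (span_cat V)" "v \<in> pts V K (span_dom s)" "w \<in> pts V K (span_cod s)"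
    and "a \<in> Obj V" "u \<in> Hom V a (apex s)"
    and "Comp V a (apex s) (span_dom s) (left_leg s) u = konst V K a (span_dom s) v"
    and "Comp V a (apex s) (span_cod s) (right_leg s) u = konst V K a (span_cod s) w"
  shows fibre_lift_in_Hom: "fibre_lift s v w a u \<in> Hom V a (fibre_ob V K s v w)"
    and fibre_pr1_lift: "Comp V a (fibre_ob V K s v w) (apex s) (fibre_pr1 V K s v w)
      (fibre_lift s v w a u) = u"
  using theI'[OF fibre_ex1[OF assms]] by (simp_all add: fibre_lift_def)

text \<open>The induced map of pullbacks is a \<open>fibre_lift\<close>, because the squares of
  \<open>t\<close> carry points of the feet to their images. The target points are variables tied by
  equations, so that they can be named freely: later they are also the original points,
  coprojections, or values of the counit.\<close>

lemma
  assumes s: "s \<in> Obj (span_cat V)" and s': "s' \<in> Obj (span_cat V)"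
    and t: "t \<in> Hom (span_cat V) s s'"
    and v: "v \<in> pts V K (span_dom s)" and w: "w \<in> pts V K (span_cod s)"
    and v': "v' = Comp V (One K) (span_dom s) (span_dom s') (on_dom t) v"
    and w': "w' = Comp V (One K) (span_cod s) (span_cod s') (on_cod t) w"
  shows fibre_map_in_Hom: "fibre_map V K s s' v w v' w' (on_apex t)
      \<in> Hom V (fibre_ob V K s v w) (fibre_ob V K s' v' w')"
    and fibre_pr1_map: "Comp V (fibre_ob V K s v w) (fibre_ob V K s' v' w') (apex s')
        (fibre_pr1 V K s' v' w') (fibre_map V K s s' v w v' w' (on_apex t))
      = Comp V (fibre_ob V K s v w) (apex s) (apex s') (on_apex t) (fibre_pr1 V K s v w)"
proof -
  have S: "span_dom s \<in> Obj V" "span_cod s \<in> Obj V" "apex s \<in> Obj V"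
    "left_leg s \<in> Hom V (apex s) (span_dom s)" "right_leg s \<in> Hom V (apex s) (span_cod s)"
    using s by (simp_all add: span_obj_iff)
  have S': "span_dom s' \<in> Obj V" "span_cod s' \<in> Obj V" "apex s' \<in> Obj V"
    "left_leg s' \<in> Hom V (apex s') (span_dom s')" "right_leg s' \<in> Hom V (apex s') (span_cod s')"
    using s' by (simp_all add: span_obj_iff)
  have T: "on_dom t \<in> Hom V (span_dom s) (span_dom s')" "on_apex t \<in> Hom V (apex s) (apex s')"
    "on_cod t \<in> Hom V (span_cod s) (span_cod s')"
    "Comp V (apex s) (apex s') (span_dom s') (left_leg s') (on_apex t)
      = Comp V (apex s) (span_dom s) (span_dom s') (on_dom t) (left_leg s)"
    "Comp V (apex s) (apex s') (span_cod s') (right_leg s') (on_apex t)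
      = Comp V (apex s) (span_cod s) (span_cod s') (on_cod t) (right_leg s)"
    using t by (simp_all add: span_hom_iff)
  have V': "v' \<in> pts V K (span_dom s')" "w' \<in> pts V K (span_cod s')"
    using v w T S S' by (simp_all add: v' w' Comp_in_Hom One_in_Obj)
  let ?q = "fibre_ob V K s v w" and ?q' = "fibre_ob V K s' v' w'" and ?p = "fibre_pr1 V K s v w"
  let ?u = "Comp V ?q (apex s) (apex s') (on_apex t) ?p"
  note F = fibre_ob_in_Obj[OF s v w] fibre_pr1_in_Hom[OF s v w]
  note F' = fibre_ob_in_Obj[OF s' V'] fibre_pr1_in_Hom[OF s' V']
  have u: "?u \<in> Hom V ?q (apex s')"
    using S S' T F by (simp add: Comp_in_Hom)
  \<comment> \<open>The square of \<open>t\<close> moves the leg past \<open>on_apex t\<close>; what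
    remains is a constant map on the fibre, whose point is then pushed along
    \<open>on_dom t\<close>.\<close>
  have "Comp V ?q (apex s') (span_dom s') (left_leg s') ?u
      = Comp V ?q (span_dom s) (span_dom s') (on_dom t)
        (Comp V ?q (apex s) (span_dom s) (left_leg s) ?p)"
    using S S' T F by (simp add: Comp_assoc)
  then have l: "Comp V ?q (apex s') (span_dom s') (left_leg s') ?u = konst V K ?q (span_dom s') v'"
    using S S' T F v by (simp only: left_leg_fibre_pr1[OF s v w] konst_postcomp v')
  have "Comp V ?q (apex s') (span_cod s') (right_leg s') ?u
      = Comp V ?q (span_cod s) (span_cod s') (on_cod t)
        (Comp V ?q (apex s) (span_cod s) (right_leg s) ?p)"
    using S S' T F by (simp add: Comp_assoc)
  then have r: "Comp V ?q (apex s') (span_cod s') (right_leg s') ?u = konst V K ?q (span_cod s') w'"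
    using S S' T F w by (simp only: right_leg_fibre_pr1[OF s v w] konst_postcomp w')
  \<comment> \<open>The equation for the projections to 1 holds for every map between the fibres,
    which leaves the defining condition of \<open>fibre_lift\<close>.\<close>
  have eq: "h \<in> Hom V ?q ?q' \<and> Comp V ?q ?q' (apex s') (fibre_pr1 V K s' v' w') h = ?u \<and>
      Comp V ?q ?q' (One K) (fibre_pr2 V K s' v' w') h = fibre_pr2 V K s v w \<longleftrightarrow>
      h \<in> Hom V ?q ?q' \<and> Comp V ?q ?q' (apex s') (fibre_pr1 V K s' v' w') h = ?u" for h
    unfolding fibre_pr2_eq[OF s v w] fibre_pr2_eq[OF s' V']
    using to_one_unique[of ?q] F F' One_in_Obj to_one_in_Hom Comp_in_Hom by metis
  have "fibre_map V K s s' v w v' w' (on_apex t) = fibre_lift s' v' w' ?q ?u"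
    unfolding fibre_map_def fibre_lift_def eq ..
  then show "fibre_map V K s s' v w v' w' (on_apex t) \<in> Hom V ?q ?q'"
    and "Comp V ?q ?q' (apex s') (fibre_pr1 V K s' v' w')
        (fibre_map V K s s' v w v' w' (on_apex t)) = ?u"
    using fibre_lift_in_Hom[OF s' V' F(1) u l r] fibre_pr1_lift[OF s' V' F(1) u l r] by simp_all
qed

section \<open>Copowers of the terminal object\<close>

lemma
  assumes "small (X :: 'u set)"
  shows copower_ob_in_Obj: "copower_ob V K X \<in> Obj V"
    and copower_in_in_Hom: "x \<in> X \<Longrightarrow> copower_in V K X x \<in> pts V K (copower_ob V K X)"
  using assms coprod_ob_in_Obj[of X "\<lambda>_. One K"] coprod_in_in_Hom[of X "\<lambda>_. One K" x] One_in_Obj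
  by (simp_all add: small_def)

lemma
  assumes "small (X :: 'u set)" "d \<in> Obj V" "\<And>x. x \<in> X \<Longrightarrow> g x \<in> pts V K d"
  shows copower_tuple_in_Hom: "cotuple V X (\<lambda>_. One K) d g \<in> Hom V (copower_ob V K X) d"
    and copower_tuple_in: "x \<in> X \<Longrightarrow> Comp V (One K) (copower_ob V K X) d
      (cotuple V X (\<lambda>_. One K) d g) (copower_in V K X x) = g x"
  using assms cotuple_in_Hom[of X "\<lambda>_. One K" d g] cotuple_in[of X "\<lambda>_. One K" d g x] One_in_Obj
  by (simp_all add: small_def)

lemma copower_eqI:
  assumes "small (X :: 'u set)" "d \<in> Obj V" "h \<in> Hom V (copower_ob V K X) d" "k
      \<in> Hom V (copower_ob V K X) d"
    and "\<And>x. x \<in> X \<Longrightarrow> Comp V (One K) (copower_ob V K X) d h (copower_in V K X x)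
      = Comp V (One K) (copower_ob V K X) d k (copower_in V K X x)"
  shows "h = k"
  by (rule coprod_eqI[OF assms(1)[unfolded small_def] One_in_Obj assms(2-5)])

lemma
  assumes "small (X :: 'u set)" "small (Y :: 'u set)" "f \<in> X \<rightarrow> Y"
  shows copower_map_in_Hom: "Far (copower V K) X Y f \<in> Hom V (copower_ob V K X) (copower_ob V K Y)"
    and copower_map_in: "x \<in> X \<Longrightarrow> Comp V (One K) (copower_ob V K X) (copower_ob V K Y)
      (Far (copower V K) X Y f) (copower_in V K X x) = copower_in V K Y (f x)"
  using assms by (auto simp: copower_def intro!: copower_tuple_in_Hom copower_tuple_in
      copower_ob_in_Obj copower_in_in_Hom)

section \<open>Sums of the entries of a matrix\<close>

lemma matrix_index_small: "p \<in> Obj (matrix_cat V) \<Longrightarrow> rows p \<times> cols p \<prec> (UNIV :: 'u set)"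
  by (simp add: matrix_obj_iff small_Times infinite_universe)

lemma entry_in_Obj: "p \<in> Obj (matrix_cat V) \<Longrightarrow> i \<in> rows p \<times> cols p \<Longrightarrow> entry p i \<in> Obj V"
  by (auto simp: matrix_obj_iff)

lemma
  assumes "p \<in> Obj (matrix_cat V)"
  shows msum_in_Obj: "msum V p \<in> Obj V"
    and msum_in_in_Hom: "i \<in> rows p \<times> cols p \<Longrightarrow> msum_in V p i \<in> Hom V (entry p i) (msum V p)"
  using assms
  by (simp_all add: coprod_ob_in_Obj coprod_in_in_Hom matrix_index_small entry_in_Obj)

lemma
  assumes p: "p \<in> Obj (matrix_cat V)" and d: "d \<in> Obj V"
    and g: "\<And>i. i \<in> rows p \<times> cols p \<Longrightarrow> g i \<in> Hom V (entry p i) d"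
  shows msum_tuple_in_Hom: "cotuple V (rows p \<times> cols p) (entry p) d g \<in> Hom V (msum V p) d"
    and msum_tuple_in: "i \<in> rows p \<times> cols p \<Longrightarrow> Comp V (entry p i) (msum V p) d
      (cotuple V (rows p \<times> cols p) (entry p) d g) (msum_in V p i) = g i"
  by (rule cotuple_in_Hom[OF matrix_index_small[OF p] entry_in_Obj[OF p] d g]
      cotuple_in[OF matrix_index_small[OF p] entry_in_Obj[OF p] d g]; assumption)+

lemma msum_eqI:
  assumes "p \<in> Obj (matrix_cat V)" "d \<in> Obj V" "h \<in> Hom V (msum V p) d" "k \<in> Hom V (msum V p) d"
    and "\<And>i. i \<in> rows p \<times> cols p \<Longrightarrow> Comp V (entry p i) (msum V p) d h (msum_in V p i)
      = Comp V (entry p i) (msum V p) d k (msum_in V p i)"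
  shows "h = k"
  by (rule coprod_eqI[OF matrix_index_small[OF assms(1)] entry_in_Obj[OF assms(1)] assms(2-5)])

lemma matrix_objD:
  assumes "p \<in> Obj (matrix_cat V)"
  shows "small (rows p)" "small (cols p)"
    "copower_ob V K (rows p) \<in> Obj V" "copower_ob V K (cols p) \<in> Obj V"
  using assms by (simp_all add: matrix_obj_iff copower_ob_in_Obj)

text \<open>Phrased for an index \<open>i\<close> with its two components, the form in which
  \<open>msum_eqI\<close> presents its goals.\<close>

lemma matrix_homD:
  assumes "t \<in> Hom (matrix_cat V) p q"
  shows "on_rows t \<in> rows p \<rightarrow> rows q" "on_cols t \<in> cols p \<rightarrow> cols q"
    "i \<in> rows p \<times> cols p \<Longrightarrow> (on_rows t (fst i), on_cols t (snd i)) \<in> rows q \<times> cols q"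
    "i \<in> rows p \<times> cols p \<Longrightarrow>
      on_entry t i \<in> Hom V (entry p i) (entry q (on_rows t (fst i), on_cols t (snd i)))"
  using assms by (auto simp: matrix_hom_iff)

section \<open>The two graph morphisms\<close>

lemma points_functor: "cat_functor V set_cat (points V K)"
proof (intro cat_functor.intro cat_functor_axioms.intro category_axioms set_cat_category,
    goal_cases)
  case (1 a)
  then show ?case using locally_small One_in_Obj by
      (simp add: points_def set_cat_def locally_small_def)
next
  case (2 a b f)
  then show ?case by (simp add: points_def set_cat_def Comp_in_Hom One_in_Obj)
next
  case (3 a)
  then show ?case by (auto simp: points_def set_cat_def Comp_Id_left One_in_Obj)
next
  case (4 a b c f g)
  then show ?case by (auto simp: points_def set_cat_def compose_def Comp_assoc Comp_in_Hom
      One_in_Obj)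
qed

lemma copower_functor: "cat_functor set_cat V
    (copower V K :: ('u set, 'u \<Rightarrow> 'u, 'o, 'u) functor_data)"
proof (intro cat_functor.intro cat_functor_axioms.intro category_axioms set_cat_category,
    goal_cases)
  case (1 X)
  then show ?case by (simp add: copower_def set_cat_def copower_ob_in_Obj)
next
  case (2 X Y f)
  then show ?case
    using copower_map_in_Hom[of X Y f] by (auto simp: copower_def set_cat_def)
next
  case (3 X)
  then have X: "small X" by (simp add: set_cat_def)
  note C = copower_ob_in_Obj[OF X]
  have id: "(\<lambda>x\<in>X. x) \<in> X \<rightarrow> X" by simp
  have "Far (copower V K) X X (\<lambda>x\<in>X. x) = Id V (copower_ob V K X)"
  proof (rule copower_eqI[OF X C copower_map_in_Hom[OF X X id] Id_in_Hom[OF C]])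
    fix x assume x: "x \<in> X"
    show "Comp V (One K) (copower_ob V K X) (copower_ob V K X)
        (Far (copower V K) X X (\<lambda>x\<in>X. x)) (copower_in V K X x)
      = Comp V (One K) (copower_ob V K X) (copower_ob V K X)
        (Id V (copower_ob V K X)) (copower_in V K X x)"
      using copower_map_in[OF X X id x] Comp_Id_left[OF One_in_Obj C copower_in_in_Hom[OF X x]] x
      by simp
  qed
  then show ?case by (simp add: set_cat_def copower_def)
next
  case (4 X Y Z f g)
  then have S: "small X" "small Y" "small Z" and f: "f \<in> X \<rightarrow> Y" and g: "g \<in> Y \<rightarrow> Z"
    by (auto simp: set_cat_def)
  note C = copower_ob_in_Obj[OF S(1)] copower_ob_in_Obj[OF S(2)] copower_ob_in_Obj[OF S(3)]
  have gf: "compose X g f \<in> X \<rightarrow> Z" using f g by (auto simp: compose_def)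
  note F = copower_map_in_Hom[OF S(1,2) f] and G = copower_map_in_Hom[OF S(2,3) g]
  have "Far (copower V K) X Z (compose X g f)
    = Comp V (copower_ob V K X) (copower_ob V K Y) (copower_ob V K Z)
      (Far (copower V K) Y Z g) (Far (copower V K) X Y f)"
  proof (rule copower_eqI[OF S(1) C(3) copower_map_in_Hom[OF S(1,3) gf] Comp_in_Hom[OF C F G]])
    fix x assume x: "x \<in> X"
    with f have fx: "f x \<in> Y" by auto
    show "Comp V (One K) (copower_ob V K X) (copower_ob V K Z)
        (Far (copower V K) X Z (compose X g f)) (copower_in V K X x)
      = Comp V (One K) (copower_ob V K X) (copower_ob V K Z)
        (Comp V (copower_ob V K X) (copower_ob V K Y) (copower_ob V K Z)
          (Far (copower V K) Y Z g) (Far (copower V K) X Y f)) (copower_in V K X x)"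
      using Comp_assoc[OF One_in_Obj C copower_in_in_Hom[OF S(1) x] F G]
        copower_map_in[OF S(1,2) f x] copower_map_in[OF S(2,3) g fx]
        copower_map_in[OF S(1,3) gf x] x
      by (simp add: compose_eq)
  qed
  then show ?case by (simp add: set_cat_def copower_def)
qed

lemma points_simps:
  "Fob (points V K) a = pts V K a"
  "Far (points V K) a b f = (\<lambda>v\<in>pts V K a. Comp V (One K) a b f v)"
  by (simp_all add: points_def)

lemma copower_Fob: "Fob (copower V K) = copower_ob V K"
  by (simp add: copower_def)

text \<open>The legs and \<open>on_apex\<close> are deliberately absent. They are cotuples and stay
  folded, characterized by their composites with the coprojections in the lemmas that
  follow.\<close>

lemma matrix_to_span_simps:
  "span_dom (Fob (matrix_to_span V K) p) = copower_ob V K (rows p)"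
  "span_cod (Fob (matrix_to_span V K) p) = copower_ob V K (cols p)"
  "apex (Fob (matrix_to_span V K) p) = msum V p"
  "on_dom (Far (matrix_to_span V K) p q t) = Far (copower V K) (rows p) (rows q) (on_rows t)"
  "on_cod (Far (matrix_to_span V K) p q t) = Far (copower V K) (cols p) (cols q) (on_cols t)"
  by (simp_all add: matrix_to_span_def)

section \<open>The functor from matrices to spans\<close>

lemma matrix_to_span_obj:
  assumes p: "p \<in> Obj (matrix_cat V)"
  shows "Fob (matrix_to_span V K) p \<in> Obj (span_cat V)"
    and left_leg_msum_in: "i \<in> rows p \<times> cols p \<Longrightarrow>
      Comp V (entry p i) (msum V p) (copower_ob V K (rows p))
        (left_leg (Fob (matrix_to_span V K) p)) (msum_in V p i)
      = konst V K (entry p i) (copower_ob V K (rows p)) (copower_in V K (rows p) (fst i))"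
    and right_leg_msum_in: "i \<in> rows p \<times> cols p \<Longrightarrow>
      Comp V (entry p i) (msum V p) (copower_ob V K (cols p))
        (right_leg (Fob (matrix_to_span V K) p)) (msum_in V p i)
      = konst V K (entry p i) (copower_ob V K (cols p)) (copower_in V K (cols p) (snd i))"
proof -
  note P = matrix_objD[OF p]
  have l: "(\<lambda>(x, y). const_at V K (rows p) (entry p (x, y)) x) i
      \<in> Hom V (entry p i) (copower_ob V K (rows p))"
    and r: "(\<lambda>(x, y). const_at V K (cols p) (entry p (x, y)) y) i
      \<in> Hom V (entry p i) (copower_ob V K (cols p))" if "i \<in> rows p \<times> cols p" for i
    using that entry_in_Obj[OF p that] P
    by (auto simp: const_at_def intro!: konst_in_Hom copower_in_in_Hom)
  show "Fob (matrix_to_span V K) p \<in> Obj (span_cat V)"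
    unfolding span_obj_iff matrix_to_span_simps
    using msum_tuple_in_Hom[OF p P(3) l] msum_tuple_in_Hom[OF p P(4) r] P msum_in_Obj[OF p]
    by (simp add: matrix_to_span_def)
  assume i: "i \<in> rows p \<times> cols p"
  show "Comp V (entry p i) (msum V p) (copower_ob V K (rows p))
        (left_leg (Fob (matrix_to_span V K) p)) (msum_in V p i)
      = konst V K (entry p i) (copower_ob V K (rows p)) (copower_in V K (rows p) (fst i))"
    using msum_tuple_in[OF p P(3) l i] by
        (simp add: matrix_to_span_def case_prod_unfold const_at_def)
  show "Comp V (entry p i) (msum V p) (copower_ob V K (cols p))
        (right_leg (Fob (matrix_to_span V K) p)) (msum_in V p i)
      = konst V K (entry p i) (copower_ob V K (cols p)) (copower_in V K (cols p) (snd i))"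
    using msum_tuple_in[OF p P(4) r i] by
        (simp add: matrix_to_span_def case_prod_unfold const_at_def)
qed

text \<open>\<open>j\<close> is determined by \<open>i\<close> but kept as a variable with an
  equation, since it takes different forms: \<open>i\<close> itself for an identity, an iterated
  image for a composite, a pair of coprojections for the unit.\<close>

lemma
  assumes p: "p \<in> Obj (matrix_cat V)" and q: "q \<in> Obj (matrix_cat V)"
    and t: "t \<in> Hom (matrix_cat V) p q"
  shows matrix_to_span_apex_in_Hom:
      "on_apex (Far (matrix_to_span V K) p q t) \<in> Hom V (msum V p) (msum V q)"
    and matrix_to_span_apex_in: "i \<in> rows p \<times> cols p \<Longrightarrow>
      j = (on_rows t (fst i), on_cols t (snd i)) \<Longrightarrow>
      Comp V (entry p i) (msum V p) (msum V q) (on_apex (Far (matrix_to_span V K) p q t))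
          (msum_in V p i)
      = Comp V (entry p i) (entry q j) (msum V q) (msum_in V q j) (on_entry t i)"
proof -
  let ?g = "\<lambda>(x, y). Comp V (entry p (x, y)) (entry q (on_rows t x, on_cols t y))
           (msum V q) (msum_in V q (on_rows t x, on_cols t y)) (on_entry t (x, y))"
  have g: "?g i \<in> Hom V (entry p i) (msum V q)" if "i \<in> rows p \<times> cols p" for i
    using matrix_homD(3,4)[OF t that] entry_in_Obj[OF p that] entry_in_Obj[OF q]
        msum_in_in_Hom[OF q]
    by (auto simp: case_prod_beta intro!: Comp_in_Hom msum_in_Obj[OF q])
  show "on_apex (Far (matrix_to_span V K) p q t) \<in> Hom V (msum V p) (msum V q)"
    using msum_tuple_in_Hom[OF p msum_in_Obj[OF q] g] by (simp add: matrix_to_span_def)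
  assume i: "i \<in> rows p \<times> cols p" and j: "j = (on_rows t (fst i), on_cols t (snd i))"
  show "Comp V (entry p i) (msum V p) (msum V q) (on_apex (Far (matrix_to_span V K) p q t))
      (msum_in V p i)
      = Comp V (entry p i) (entry q j) (msum V q) (msum_in V q j) (on_entry t i)"
    using msum_tuple_in[OF p msum_in_Obj[OF q] g i] j by
        (simp add: matrix_to_span_def case_prod_unfold)
qed


lemma copower_id: "small (X :: 'u set) \<Longrightarrow>
    Far (copower V K) X X (\<lambda>x\<in>X. x) = Id V (copower_ob V K X)"
  using cat_functor.Far_Id[OF copower_functor, of X] by (simp add: set_cat_def copower_def)

lemma copower_comp:
  assumes "small (X :: 'u set)" "small Y" "small Z" "f \<in> X \<rightarrow>\<^sub>E Y" "g \<in> Y \<rightarrow>\<^sub>E Z"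
  shows "Far (copower V K) X Z (compose X g f)
    = Comp V (copower_ob V K X) (copower_ob V K Y) (copower_ob V K Z)
      (Far (copower V K) Y Z g) (Far (copower V K) X Y f)"
  using cat_functor.Far_Comp[OF copower_functor, of X Y Z f g] assms
  by (simp add: set_cat_def copower_Fob)

text \<open>Left and right legs are treated at once, with \<pi> and \<pi>' selecting the row or the
  column index. On the summand at \<open>i\<close> both composites are constant at the coprojection
  of the copower of \<open>Y\<close> indexed by \<open>f (\<pi> i)\<close>.\<close>

lemma leg_square:
  fixes X Y :: "'u set"
  assumes p: "p \<in> Obj (matrix_cat V)" and q: "q \<in> Obj (matrix_cat V)"
    and t: "t \<in> Hom (matrix_cat V) p q"
    and X: "small X" and Y: "small Y" and f: "f \<in> X \<rightarrow> Y"
    and l: "l \<in> Hom V (msum V p) (copower_ob V K X)"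
    and l': "l' \<in> Hom V (msum V q) (copower_ob V K Y)"
    and l_in: "\<And>i. i \<in> rows p \<times> cols p \<Longrightarrow>
      Comp V (entry p i) (msum V p) (copower_ob V K X) l (msum_in V p i)
      = konst V K (entry p i) (copower_ob V K X) (copower_in V K X (\<pi> i))"
    and l'_in: "\<And>j. j \<in> rows q \<times> cols q \<Longrightarrow>
      Comp V (entry q j) (msum V q) (copower_ob V K Y) l' (msum_in V q j)
      = konst V K (entry q j) (copower_ob V K Y) (copower_in V K Y (\<pi>' j))"
    and \<pi>: "\<And>i. i \<in> rows p \<times> cols p \<Longrightarrow> \<pi> i \<in> X"
    and \<pi>': "\<And>i. i \<in> rows p \<times> cols p \<Longrightarrow> \<pi>' (on_rows t (fst i), on_cols t (snd i)) = f (\<pi> i)"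
  shows "Comp V (msum V p) (msum V q) (copower_ob V K Y) l'
      (on_apex (Far (matrix_to_span V K) p q t))
    = Comp V (msum V p) (copower_ob V K X) (copower_ob V K Y) (Far (copower V K) X Y f) l"
proof -
  note C = copower_ob_in_Obj[OF X] copower_ob_in_Obj[OF Y] and m = copower_map_in_Hom[OF X Y f]
  note M = msum_in_Obj[OF p] msum_in_Obj[OF q] and A = matrix_to_span_apex_in_Hom[OF p q t]
  let ?a = "on_apex (Far (matrix_to_span V K) p q t)"
  show ?thesis
  proof (rule msum_eqI[OF p C(2) Comp_in_Hom[OF M C(2) A l'] Comp_in_Hom[OF M(1) C l m]])
    fix i assume i: "i \<in> rows p \<times> cols p"
    let ?j = "(on_rows t (fst i), on_cols t (snd i))"
    note T = matrix_homD(3,4)[OF t i]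
    note e = entry_in_Obj[OF p i] entry_in_Obj[OF q T(1)]
    note I = msum_in_in_Hom[OF p i] msum_in_in_Hom[OF q T(1)]
    have fx: "f (\<pi> i) \<in> Y" using f \<pi>[OF i] by auto
    note x = copower_in_in_Hom[OF X \<pi>[OF i]] copower_in_in_Hom[OF Y fx]
    have "Comp V (entry p i) (msum V p) (copower_ob V K Y)
        (Comp V (msum V p) (msum V q) (copower_ob V K Y) l' ?a) (msum_in V p i)
      = Comp V (entry p i) (msum V q) (copower_ob V K Y) l'
        (Comp V (entry p i) (entry q ?j) (msum V q) (msum_in V q ?j) (on_entry t i))"
      using Comp_assoc[OF e(1) M C(2) I(1) A l'] by
          (simp add: matrix_to_span_apex_in[OF p q t i refl])
    also have "\<dots> = konst V K (entry p i) (copower_ob V K Y) (copower_in V K Y (f (\<pi> i)))"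
      using Comp_assoc[OF e M(2) C(2) T(2) I(2) l'] konst_precomp[OF e C(2) x(2) T(2)]
      by (simp add: l'_in[OF T(1)] \<pi>'[OF i])
    also have "\<dots> = Comp V (entry p i) (copower_ob V K X) (copower_ob V K Y)
        (Far (copower V K) X Y f)
        (konst V K (entry p i) (copower_ob V K X) (copower_in V K X (\<pi> i)))"
      using konst_postcomp[OF e(1) C x(1) m] by (simp add: copower_map_in[OF X Y f \<pi>[OF i]])
    also have "\<dots> = Comp V (entry p i) (msum V p) (copower_ob V K Y)
        (Comp V (msum V p) (copower_ob V K X) (copower_ob V K Y) (Far (copower V K) X Y f) l)
          (msum_in V p i)"
      using Comp_assoc[OF e(1) M(1) C I(1) l m] by (simp add: l_in[OF i])
    finally show "Comp V (entry p i) (msum V p) (copower_ob V K Y)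
        (Comp V (msum V p) (msum V q) (copower_ob V K Y) l' ?a) (msum_in V p i)
      = \<dots>" .
  qed
qed

lemma matrix_to_span_hom:
  assumes p: "p \<in> Obj (matrix_cat V)" and q: "q \<in> Obj (matrix_cat V)"
    and t: "t \<in> Hom (matrix_cat V) p q"
  shows "Far (matrix_to_span V K) p q t
    \<in> Hom (span_cat V) (Fob (matrix_to_span V K) p) (Fob (matrix_to_span V K) q)"
proof -
  note P = matrix_objD[OF p] and Q = matrix_objD[OF q] and T = matrix_homD[OF t]
  note Lp = matrix_to_span_obj(1)[OF p, unfolded span_obj_iff matrix_to_span_simps]
  note Lq = matrix_to_span_obj(1)[OF q, unfolded span_obj_iff matrix_to_span_simps]
  have "Comp V (msum V p) (msum V q) (copower_ob V K (rows q))
      (left_leg (Fob (matrix_to_span V K) q))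
      (on_apex (Far (matrix_to_span V K) p q t))
    = Comp V (msum V p) (copower_ob V K (rows p)) (copower_ob V K (rows q))
      (Far (copower V K) (rows p) (rows q) (on_rows t)) (left_leg (Fob (matrix_to_span V K) p))"
    by (rule leg_square[OF p q t P(1) Q(1) T(1) _ _ left_leg_msum_in[OF p] left_leg_msum_in[OF q]])
      (use Lp Lq in auto)
  moreover have "Comp V (msum V p) (msum V q) (copower_ob V K (cols q))
      (right_leg (Fob (matrix_to_span V K) q)) (on_apex (Far (matrix_to_span V K) p q t))
    = Comp V (msum V p) (copower_ob V K (cols p)) (copower_ob V K (cols q))
      (Far (copower V K) (cols p) (cols q) (on_cols t)) (right_leg (Fob (matrix_to_span V K) p))"
    by (rule leg_square[OF p q t P(2) Q(2) T(2) _ _ right_leg_msum_in[OF p]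
        right_leg_msum_in[OF q]])
      (use Lp Lq in auto)
  ultimately show ?thesis
    unfolding span_hom_iff matrix_to_span_simps
    using copower_map_in_Hom[OF P(1) Q(1) T(1)] copower_map_in_Hom[OF P(2) Q(2) T(2)]
      matrix_to_span_apex_in_Hom[OF p q t]
    by simp
qed

lemma matrix_to_span_functor: "cat_functor (matrix_cat V) (span_cat V) (matrix_to_span V K)"
proof (intro cat_functor.intro cat_functor_axioms.intro matrix_cat_category span_cat_category
    category_axioms matrix_to_span_obj(1) matrix_to_span_hom)
  fix p assume p: "p \<in> Obj (matrix_cat V)"
  interpret M: category "matrix_cat V" by (rule matrix_cat_category) (rule category_axioms)
  note id = M.Id_in_Hom[OF p]
  show "Far (matrix_to_span V K) p p (Id (matrix_cat V) p)
    = Id (span_cat V) (Fob (matrix_to_span V K) p)"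
  proof (rule span_mor.equality)
    show "on_apex (Far (matrix_to_span V K) p p (Id (matrix_cat V) p))
      = on_apex (Id (span_cat V) (Fob (matrix_to_span V K) p))"
      unfolding span_id_simps matrix_to_span_simps
    proof (rule msum_eqI[OF p msum_in_Obj[OF p] matrix_to_span_apex_in_Hom[OF p p id]
          Id_in_Hom[OF msum_in_Obj[OF p]]])
      fix i assume i: "i \<in> rows p \<times> cols p"
      have j: "i = (on_rows (Id (matrix_cat V) p) (fst i), on_cols (Id (matrix_cat V) p) (snd i))"
        and e: "on_entry (Id (matrix_cat V) p) i = Id V (entry p i)"
        using i by (auto simp: matrix_id_simps)
      show "Comp V (entry p i) (msum V p) (msum V p)
          (on_apex (Far (matrix_to_span V K) p p (Id (matrix_cat V) p))) (msum_in V p i)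
        = Comp V (entry p i) (msum V p) (msum V p) (Id V (msum V p)) (msum_in V p i)"
        using msum_in_Obj[OF p] msum_in_in_Hom[OF p i] entry_in_Obj[OF p i]
        by (simp add: matrix_to_span_apex_in[OF p p id i j] e Comp_Id_left Comp_Id_right)
    qed
  qed (use matrix_objD[OF p] in
      \<open>simp_all add: matrix_to_span_simps span_id_simps matrix_id_simps copower_id\<close>)
next
  fix p q r s t
  assume p: "p \<in> Obj (matrix_cat V)" and q: "q \<in> Obj (matrix_cat V)" and r: "r \<in> Obj (matrix_cat V)"
    and s: "s \<in> Hom (matrix_cat V) p q" and t: "t \<in> Hom (matrix_cat V) q r"
  interpret M: category "matrix_cat V" by (rule matrix_cat_category) (rule category_axioms)
  let ?F = "matrix_to_span V K"
  let ?ts = "Comp (matrix_cat V) p q r t s"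
  note ts = M.Comp_in_Hom[OF p q r s t]
  note M = msum_in_Obj[OF p] msum_in_Obj[OF q] msum_in_Obj[OF r]
  note A = matrix_to_span_apex_in_Hom[OF p q s] matrix_to_span_apex_in_Hom[OF q r t]
  show "Far ?F p r ?ts = Comp (span_cat V) (Fob ?F p) (Fob ?F q) (Fob ?F r) (Far ?F q r t)
      (Far ?F p q s)"
  proof (rule span_mor.equality)
    show "on_apex (Far ?F p r ?ts)
      = on_apex (Comp (span_cat V) (Fob ?F p) (Fob ?F q) (Fob ?F r) (Far ?F q r t) (Far ?F p q s))"
      unfolding span_comp_simps matrix_to_span_simps
    proof (rule msum_eqI[OF p M(3) matrix_to_span_apex_in_Hom[OF p r ts] Comp_in_Hom[OF M A]])
      fix i assume i: "i \<in> rows p \<times> cols p"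
      \<comment> \<open>The summand at \<open>i\<close> is sent to the one at \<open>j\<close> by
        \<open>s\<close> and to the one at \<open>k\<close> by \<open>t\<close> after
        \<open>s\<close>; naming the indices keeps the intermediate sums apart.\<close>
      define j where "j = (on_rows s (fst i), on_cols s (snd i))"
      define k where "k = (on_rows t (fst j), on_cols t (snd j))"
      have j: "j \<in> rows q \<times> cols q" and k: "k \<in> rows r \<times> cols r"
        using matrix_homD(3)[OF s i] matrix_homD(3)[OF t, of j] by (simp_all add: j_def k_def)
      have sj: "on_entry s i \<in> Hom V (entry p i) (entry q j)"
        and tk: "on_entry t j \<in> Hom V (entry q j) (entry r k)"
        using matrix_homD(4)[OF s i] matrix_homD(4)[OF t j] by (simp_all add: j_def k_def)
      have k': "k = (on_rows ?ts (fst i), on_cols ?ts (snd i))"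
        and e: "on_entry ?ts i = Comp V (entry p i) (entry q j) (entry r k) (on_entry t j)
            (on_entry s i)"
        using i by (auto simp: matrix_comp_simps compose_eq j_def k_def)
      note E = entry_in_Obj[OF p i] entry_in_Obj[OF q j] entry_in_Obj[OF r k]
      note I = msum_in_in_Hom[OF p i] msum_in_in_Hom[OF q j] msum_in_in_Hom[OF r k]
      have "Comp V (entry p i) (msum V p) (msum V r) (on_apex (Far ?F p r ?ts)) (msum_in V p i)
        = Comp V (entry p i) (entry q j) (msum V r)
          (Comp V (entry q j) (entry r k) (msum V r) (msum_in V r k) (on_entry t j)) (on_entry s i)"
        using Comp_assoc[OF E M(3) sj tk I(3)]
        by (simp add: matrix_to_span_apex_in[OF p r ts i k'] e)
      also have "\<dots> = Comp V (entry p i) (msum V q) (msum V r) (on_apex (Far ?F q r t))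
          (Comp V (entry p i) (entry q j) (msum V q) (msum_in V q j) (on_entry s i))"
        using Comp_assoc[OF E(1,2) M(2,3) sj I(2) A(2)]
        by (simp add: matrix_to_span_apex_in[OF q r t j k_def])
      also have "\<dots> = Comp V (entry p i) (msum V p) (msum V r)
          (Comp V (msum V p) (msum V q) (msum V r) (on_apex (Far ?F q r t))
            (on_apex (Far ?F p q s)))
          (msum_in V p i)"
        using Comp_assoc[OF E(1) M I(1) A]
        by (simp add: matrix_to_span_apex_in[OF p q s i j_def])
      finally show "Comp V (entry p i) (msum V p) (msum V r) (on_apex (Far ?F p r ?ts))
          (msum_in V p i)
        = \<dots>" .
    qed
  qed (use matrix_objD[OF p] matrix_objD[OF q] matrix_objD[OF r] s t in
      \<open>simp_all add: matrix_to_span_simps span_comp_simps matrix_comp_simps copower_comp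
          matrix_hom_iff\<close>)
qed

section \<open>The functor from spans to matrices\<close>

lemma span_to_matrix_simps:
  "rows (Fob (span_to_matrix V K) s) = pts V K (span_dom s)"
  "cols (Fob (span_to_matrix V K) s) = pts V K (span_cod s)"
  "entry (Fob (span_to_matrix V K) s)
    = (\<lambda>(v, w)\<in>pts V K (span_dom s) \<times> pts V K (span_cod s). fibre_ob V K s v w)"
  "on_rows (Far (span_to_matrix V K) s s' t) = Far (points V K) (span_dom s) (span_dom s')
    (on_dom t)"
  "on_cols (Far (span_to_matrix V K) s s' t) = Far (points V K) (span_cod s) (span_cod s')
    (on_cod t)"
  "on_entry (Far (span_to_matrix V K) s s' t)
    = (\<lambda>(v, w)\<in>pts V K (span_dom s) \<times> pts V K (span_cod s). fibre_map V K s s' v w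
        (Comp V (One K) (span_dom s) (span_dom s') (on_dom t) v)
        (Comp V (One K) (span_cod s) (span_cod s') (on_cod t) w) (on_apex t))"
  by (simp_all add: span_to_matrix_def)

lemma span_objD:
  assumes "s \<in> Obj (span_cat V)"
  shows "span_dom s \<in> Obj V" "span_cod s \<in> Obj V" "apex s \<in> Obj V"
    "left_leg s \<in> Hom V (apex s) (span_dom s)" "right_leg s \<in> Hom V (apex s) (span_cod s)"
    "small (pts V K (span_dom s))" "small (pts V K (span_cod s))"
  using assms locally_small One_in_Obj by (auto simp: span_obj_iff locally_small_def)

lemma span_homD:
  assumes "t \<in> Hom (span_cat V) s s'"
  shows "on_dom t \<in> Hom V (span_dom s) (span_dom s')" "on_apex t \<in> Hom V (apex s) (apex s')"
    "on_cod t \<in> Hom V (span_cod s) (span_cod s')"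
  using assms by (simp_all add: span_hom_iff)

lemma points_map_in:
  "a \<in> Obj V \<Longrightarrow> b \<in> Obj V \<Longrightarrow> f \<in> Hom V a b \<Longrightarrow> v \<in> pts V K a \<Longrightarrow> Comp V (One K) a b f v \<in> pts V K b"
  by (simp add: Comp_in_Hom One_in_Obj)

lemma span_to_matrix_obj:
  assumes s: "s \<in> Obj (span_cat V)"
  shows "Fob (span_to_matrix V K) s \<in> Obj (matrix_cat V)"
  using span_objD[OF s] fibre_ob_in_Obj[OF s]
  by (auto simp: matrix_obj_iff span_to_matrix_simps)

lemma span_to_matrix_hom:
  assumes s: "s \<in> Obj (span_cat V)" and s': "s' \<in> Obj (span_cat V)"
    and t: "t \<in> Hom (span_cat V) s s'"
  shows "Far (span_to_matrix V K) s s' t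
    \<in> Hom (matrix_cat V) (Fob (span_to_matrix V K) s) (Fob (span_to_matrix V K) s')"
  using span_objD[OF s] span_objD[OF s'] span_homD[OF t] fibre_map_in_Hom[OF s s' t _ _ refl refl]
  by (simp add: matrix_hom_iff span_to_matrix_simps points_simps points_map_in PiE_iff)

lemma span_to_matrix_functor: "cat_functor (span_cat V) (matrix_cat V) (span_to_matrix V K)"
proof (intro cat_functor.intro cat_functor_axioms.intro matrix_cat_category span_cat_category
    category_axioms span_to_matrix_obj span_to_matrix_hom)
  interpret M: category "matrix_cat V" by (rule matrix_cat_category) (rule category_axioms)
  interpret S: category "span_cat V" by (rule span_cat_category) (rule category_axioms)
  fix s assume s: "s \<in> Obj (span_cat V)"
  note S = span_objD[OF s]
  note id = S.Id_in_Hom[OF s]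
  let ?R = "span_to_matrix V K"
  show "Far ?R s s (Id (span_cat V) s) = Id (matrix_cat V) (Fob ?R s)"
  proof (rule matrix_hom_eqI[OF span_to_matrix_hom[OF s s id]
      M.Id_in_Hom[OF span_to_matrix_obj[OF s]]])
    fix v w assume "v \<in> rows (Fob ?R s)" "w \<in> cols (Fob ?R s)"
    then have v: "v \<in> pts V K (span_dom s)" and w: "w \<in> pts V K (span_cod s)"
      by (simp_all add: span_to_matrix_simps)
    \<comment> \<open>The target fibre is indexed by the images of the points under the identity
      morphism; only after identifying these with \<open>v\<close> and \<open>w\<close> are the two
      sides parallel.\<close>
    have vw: "v = Comp V (One K) (span_dom s) (span_dom s) (on_dom (Id (span_cat V) s)) v"
      "w = Comp V (One K) (span_cod s) (span_cod s) (on_cod (Id (span_cat V) s)) w"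
      using S v w One_in_Obj by (simp_all add: span_id_simps Comp_Id_left)
    note q = fibre_ob_in_Obj[OF s v w] fibre_pr1_in_Hom[OF s v w]
    have "fibre_map V K s s v w v w (on_apex (Id (span_cat V) s)) = Id V (fibre_ob V K s v w)"
      by (rule fibre_eqI[OF s v w q(1) fibre_map_in_Hom[OF s s id v w vw] Id_in_Hom[OF q(1)]])
        (use q S fibre_pr1_map[OF s s id v w vw] in
          \<open>simp add: span_id_simps Comp_Id_left Comp_Id_right\<close>)
    then show "on_entry (Far ?R s s (Id (span_cat V) s)) (v, w)
      = on_entry (Id (matrix_cat V) (Fob ?R s)) (v, w)"
      using v w by (simp add: span_to_matrix_simps matrix_id_simps flip: vw)
  qed (use S One_in_Obj in \<open>simp_all add: span_to_matrix_simps matrix_id_simps span_id_simps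
      points_simps
      Comp_Id_left\<close>)
next
  interpret M: category "matrix_cat V" by (rule matrix_cat_category) (rule category_axioms)
  interpret S: category "span_cat V" by (rule span_cat_category) (rule category_axioms)
  fix p q r s t
  assume p: "p \<in> Obj (span_cat V)" and q: "q \<in> Obj (span_cat V)" and r: "r \<in> Obj (span_cat V)"
    and s: "s \<in> Hom (span_cat V) p q" and t: "t \<in> Hom (span_cat V) q r"
  let ?R = "span_to_matrix V K"
  let ?ts = "Comp (span_cat V) p q r t s"
  note ts = S.Comp_in_Hom[OF p q r s t]
  note O = span_to_matrix_obj[OF p] span_to_matrix_obj[OF q] span_to_matrix_obj[OF r]
  note P = span_objD[OF p] and Q = span_objD[OF q] and R = span_objD[OF r]
  note H = span_homD[OF s] span_homD[OF t]
  show "Far ?R p r ?ts = Comp (matrix_cat V) (Fob ?R p) (Fob ?R q) (Fob ?R r) (Far ?R q r t)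
      (Far ?R p q s)"
  proof (rule matrix_hom_eqI[OF span_to_matrix_hom[OF p r ts]
        M.Comp_in_Hom[OF O span_to_matrix_hom[OF p q s] span_to_matrix_hom[OF q r t]]])
    fix v w assume "v \<in> rows (Fob ?R p)" "w \<in> cols (Fob ?R p)"
    then have v: "v \<in> pts V K (span_dom p)" and w: "w \<in> pts V K (span_cod p)"
      by (simp_all add: span_to_matrix_simps)
    define v' where "v' = Comp V (One K) (span_dom p) (span_dom q) (on_dom s) v"
    define w' where "w' = Comp V (One K) (span_cod p) (span_cod q) (on_cod s) w"
    define v'' where "v'' = Comp V (One K) (span_dom q) (span_dom r) (on_dom t) v'"
    define w'' where "w'' = Comp V (One K) (span_cod q) (span_cod r) (on_cod t) w'"
    have v': "v' \<in> pts V K (span_dom q)" and w': "w' \<in> pts V K (span_cod q)"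
      using v w P Q H by (simp_all add: v'_def w'_def points_map_in)
    have v'': "v'' \<in> pts V K (span_dom r)" and w'': "w'' \<in> pts V K (span_cod r)"
      using v' w' Q R H by (simp_all add: v''_def w''_def points_map_in)
    \<comment> \<open>Iterated images agree with images under the composite, so both sides map into
      the same fibre.\<close>
    have vw: "v'' = Comp V (One K) (span_dom p) (span_dom r) (on_dom ?ts) v"
      "w'' = Comp V (One K) (span_cod p) (span_cod r) (on_cod ?ts) w"
      using v w P Q R H One_in_Obj
      by (simp_all add: span_comp_simps v'_def w'_def v''_def w''_def Comp_assoc)
    note F = fibre_ob_in_Obj[OF p v w] fibre_ob_in_Obj[OF q v' w'] fibre_ob_in_Obj[OF r v'' w'']
    note pr = fibre_pr1_in_Hom[OF p v w] fibre_pr1_in_Hom[OF q v' w'] fibre_pr1_in_Hom[OF r v'' w'']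
    note ms = fibre_map_in_Hom[OF p q s v w v'_def w'_def] and mt
        = fibre_map_in_Hom[OF q r t v' w' v''_def w''_def]
    let ?ms = "fibre_map V K p q v w v' w' (on_apex s)"
    let ?mt = "fibre_map V K q r v' w' v'' w'' (on_apex t)"
    let ?f = "fibre_ob V K p v w" and ?f' = "fibre_ob V K q v' w'" and ?f''
        = "fibre_ob V K r v'' w''"
    have "fibre_map V K p r v w v'' w'' (on_apex ?ts) = Comp V ?f ?f' ?f'' ?mt ?ms"
    proof (rule fibre_eqI[OF r v'' w'' F(1) fibre_map_in_Hom[OF p r ts v w vw]
        Comp_in_Hom[OF F ms mt]])
      have "Comp V ?f ?f'' (apex r) (fibre_pr1 V K r v'' w'') (Comp V ?f ?f' ?f'' ?mt ?ms)
        = Comp V ?f ?f' (apex r) (Comp V ?f' (apex q) (apex r) (on_apex t)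
            (fibre_pr1 V K q v' w')) ?ms"
        using Comp_assoc[OF F R(3) ms mt pr(3)] by
            (simp add: fibre_pr1_map[OF q r t v' w' v''_def w''_def])
      also have "\<dots> = Comp V ?f (apex q) (apex r) (on_apex t)
          (Comp V ?f (apex p) (apex q) (on_apex s) (fibre_pr1 V K p v w))"
        using Comp_assoc[OF F(1,2) Q(3) R(3) ms pr(2) H(5)]
        by (simp add: fibre_pr1_map[OF p q s v w v'_def w'_def])
      also have "\<dots> = Comp V ?f ?f'' (apex r) (fibre_pr1 V K r v'' w'')
          (fibre_map V K p r v w v'' w'' (on_apex ?ts))"
        using Comp_assoc[OF F(1) P(3) Q(3) R(3) pr(1) H(2) H(5)] fibre_pr1_map[OF p r ts v w vw]
        by (simp add: span_comp_simps)
      finally show "Comp V ?f ?f'' (apex r) (fibre_pr1 V K r v'' w'')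
          (fibre_map V K p r v w v'' w'' (on_apex ?ts))
        = Comp V ?f ?f'' (apex r) (fibre_pr1 V K r v'' w'') (Comp V ?f ?f' ?f'' ?mt ?ms)" ..
    qed
    then show "on_entry (Far ?R p r ?ts) (v, w)
      = on_entry (Comp (matrix_cat V) (Fob ?R p) (Fob ?R q) (Fob ?R r) (Far ?R q r t)
          (Far ?R p q s)) (v, w)"
      using v w v' w' v'' w''
      by (simp add: span_to_matrix_simps matrix_comp_simps points_simps flip: vw v'_def w'_def
          v''_def w''_def)
  qed (use P Q R H One_in_Obj in \<open>simp_all add: span_to_matrix_simps matrix_comp_simps
      span_comp_simps
      points_simps compose_eq points_map_in Comp_assoc\<close>)
qed

section \<open>The two graphs and the morphisms between them\<close>

lemma matrix_graph_cat_graph: "cat_graph (matrix_graph V)"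
proof (rule cat_graph.intro)
  show "cat_functor (G1 (matrix_graph V)) (G0 (matrix_graph V)) (Src (matrix_graph V))"
    "cat_functor (G1 (matrix_graph V)) (G0 (matrix_graph V)) (Tgt (matrix_graph V))"
    unfolding cat_functor_def cat_functor_axioms_def
    using matrix_cat_category[OF category_axioms] set_cat_category
    by (simp_all add: matrix_graph_def matrix_obj_iff matrix_hom_iff matrix_id_simps
        matrix_comp_simps set_cat_def)
qed

lemma span_graph_cat_graph: "cat_graph (span_graph V)"
proof (rule cat_graph.intro)
  show "cat_functor (G1 (span_graph V)) (G0 (span_graph V)) (Src (span_graph V))"
    "cat_functor (G1 (span_graph V)) (G0 (span_graph V)) (Tgt (span_graph V))"
    unfolding cat_functor_def cat_functor_axioms_def
    using span_cat_category[OF category_axioms] category_axioms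
    by (simp_all add: span_graph_def span_obj_iff span_hom_iff span_id_simps span_comp_simps)
qed

lemma copower_graph_morphism:
  "graph_morphism (matrix_graph V) (span_graph V) (copower_graph_mor V K)"
  by (intro graph_morphism.intro graph_morphism_axioms.intro matrix_graph_cat_graph
      span_graph_cat_graph)
    (simp_all add: matrix_graph_def span_graph_def copower_graph_mor_def copower_functor
      matrix_to_span_functor functor_eq_def functor_comp_def matrix_to_span_simps copower_Fob)

lemma points_graph_morphism:
  "graph_morphism (span_graph V) (matrix_graph V) (points_graph_mor V K)"
  by (intro graph_morphism.intro graph_morphism_axioms.intro matrix_graph_cat_graph
      span_graph_cat_graph)
    (simp_all add: matrix_graph_def span_graph_def points_graph_mor_def points_functor
      span_to_matrix_functor functor_eq_def functor_comp_def span_to_matrix_simps points_simps)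

section \<open>The unit and the counit\<close>

abbreviation (input) L where "L \<equiv> matrix_to_span V K"
abbreviation (input) R where "R \<equiv> span_to_matrix V K"

text \<open>A coprojection 1 -> X * 1 is itself a point of X * 1 and can therefore serve as the
  value at \<open>x\<close>. The restriction makes the function extensional, as morphisms of
  \<open>set_cat\<close> are.\<close>

definition set_unit :: "'u set \<Rightarrow> 'u \<Rightarrow> 'u" where
  "set_unit X = (\<lambda>x\<in>X. copower_in V K X x)"

text \<open>The lift exists because the legs of \<open>Fob L p\<close> are defined by being constant
  on each summand, at exactly the two coprojections used here as base points.\<close>

definition matrix_unit :: "('o, 'u) matrix \<Rightarrow> 'u matrix_mor" where
  "matrix_unit p = \<lparr>on_rows = set_unit (rows p), on_cols = set_unit (cols p),
     on_entry = (\<lambda>(x, y)\<in>rows p \<times> cols p.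
       fibre_lift (Fob L p) (copower_in V K (rows p) x) (copower_in V K (cols p) y)
         (entry p (x, y)) (msum_in V p (x, y)))\<rparr>"

text \<open>Evaluation at points. The copower is indexed by the hom-set itself, so each point is its
  own component and the cotuple is that of the identity family.\<close>

definition ob_counit :: "'o \<Rightarrow> 'u" where
  "ob_counit a = cotuple V (pts V K a) (\<lambda>_. One K) a (\<lambda>v. v)"

definition span_counit :: "('o, 'u) span \<Rightarrow> 'u span_mor" where
  "span_counit s = \<lparr>on_dom = ob_counit (span_dom s),
     on_apex = cotuple V (rows (Fob R s) \<times> cols (Fob R s)) (entry (Fob R s)) (apex s)
       (\<lambda>(v, w). fibre_pr1 V K s v w),
     on_cod = ob_counit (span_cod s)\<rparr>"

lemma set_unit_in_Hom: "small X \<Longrightarrow> set_unit X \<in> X \<rightarrow>\<^sub>E pts V K (copower_ob V K X)"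
  by (auto simp: set_unit_def copower_in_in_Hom)

text \<open>Since projections of fibres are monic, the second equation determines the entries of the
  unit. Naturality and both triangle identities use the entries only through these two
  facts.\<close>

lemma
  assumes p: "p \<in> Obj (matrix_cat V)" and x: "x \<in> rows p" and y: "y \<in> cols p"
  shows matrix_unit_entry_in_Hom: "on_entry (matrix_unit p) (x, y) \<in> Hom V (entry p (x, y))
      (fibre_ob V K (Fob L p) (copower_in V K (rows p) x) (copower_in V K (cols p) y))"
    and fibre_pr1_matrix_unit: "Comp V (entry p (x, y))
        (fibre_ob V K (Fob L p) (copower_in V K (rows p) x) (copower_in V K (cols p) y))
        (msum V p)
        (fibre_pr1 V K (Fob L p) (copower_in V K (rows p) x) (copower_in V K (cols p) y))
        (on_entry (matrix_unit p) (x, y))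
      = msum_in V p (x, y)"
proof -
  let ?v = "copower_in V K (rows p) x" and ?w = "copower_in V K (cols p) y"
  note P = matrix_objD[OF p]
  have i: "(x, y) \<in> rows p \<times> cols p" using x y by simp
  note s = matrix_to_span_obj(1)[OF p]
  have v: "?v \<in> pts V K (span_dom (Fob L p))" and w: "?w \<in> pts V K (span_cod (Fob L p))"
    using P x y by (simp_all add: matrix_to_span_simps copower_in_in_Hom)
  have u: "msum_in V p (x, y) \<in> Hom V (entry p (x, y)) (apex (Fob L p))"
    using msum_in_in_Hom[OF p i] by (simp add: matrix_to_span_simps)
  have l: "Comp V (entry p (x, y)) (apex (Fob L p)) (span_dom (Fob L p)) (left_leg (Fob L p))
      (msum_in V p (x, y)) = konst V K (entry p (x, y)) (span_dom (Fob L p)) ?v"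
    using left_leg_msum_in[OF p i] by (simp add: matrix_to_span_simps)
  have r: "Comp V (entry p (x, y)) (apex (Fob L p)) (span_cod (Fob L p)) (right_leg (Fob L p))
      (msum_in V p (x, y)) = konst V K (entry p (x, y)) (span_cod (Fob L p)) ?w"
    using right_leg_msum_in[OF p i] by (simp add: matrix_to_span_simps)
  note lift = fibre_lift_in_Hom[OF s v w entry_in_Obj[OF p i] u l r]
    fibre_pr1_lift[OF s v w entry_in_Obj[OF p i] u l r, unfolded matrix_to_span_simps]
  show "on_entry (matrix_unit p) (x, y) \<in> Hom V (entry p (x, y)) (fibre_ob V K (Fob L p) ?v ?w)"
    and "Comp V (entry p (x, y)) (fibre_ob V K (Fob L p) ?v ?w) (msum V p)
      (fibre_pr1 V K (Fob L p) ?v ?w) (on_entry (matrix_unit p) (x, y)) = msum_in V p (x, y)"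
    using lift x y by (simp_all add: matrix_unit_def)
qed

lemma matrix_unit_simps:
  "on_rows (matrix_unit p) = set_unit (rows p)" "on_cols (matrix_unit p) = set_unit (cols p)"
  by (simp_all add: matrix_unit_def)

lemma matrix_unit_in_Hom:
  assumes p: "p \<in> Obj (matrix_cat V)"
  shows "matrix_unit p \<in> Hom (matrix_cat V) p (Fob R (Fob L p))"
proof -
  note P = matrix_objD[OF p]
  have "on_entry (matrix_unit p) \<in> extensional (rows p \<times> cols p)"
    by (simp add: matrix_unit_def)
  then show ?thesis
    using matrix_unit_entry_in_Hom[OF p] P
    by (simp add: matrix_hom_iff span_to_matrix_simps matrix_to_span_simps matrix_unit_simps
        set_unit_in_Hom copower_in_in_Hom) (simp add: set_unit_def copower_in_in_Hom)
qed

lemma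
  assumes a: "a \<in> Obj V"
  shows ob_counit_in_Hom: "ob_counit a \<in> Hom V (copower_ob V K (pts V K a)) a"
    and ob_counit_in: "v \<in> pts V K a \<Longrightarrow> Comp V (One K) (copower_ob V K (pts V K a)) a
      (ob_counit a) (copower_in V K (pts V K a) v) = v"
proof -
  have small: "small (pts V K a)"
    using locally_small a One_in_Obj by (simp add: locally_small_def)
  show "ob_counit a \<in> Hom V (copower_ob V K (pts V K a)) a"
    unfolding ob_counit_def by (rule copower_tuple_in_Hom[OF small a])
  show "Comp V (One K) (copower_ob V K (pts V K a)) a
      (ob_counit a) (copower_in V K (pts V K a) v) = v" if "v \<in> pts V K a"
    unfolding ob_counit_def by (rule copower_tuple_in[OF small a _ that])
qed

lemma
  assumes s: "s \<in> Obj (span_cat V)"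
  shows span_counit_apex_in_Hom: "on_apex (span_counit s) \<in> Hom V (msum V (Fob R s)) (apex s)"
    and span_counit_apex_in: "v \<in> pts V K (span_dom s) \<Longrightarrow> w \<in> pts V K (span_cod s) \<Longrightarrow>
      Comp V (fibre_ob V K s v w) (msum V (Fob R s)) (apex s)
        (on_apex (span_counit s)) (msum_in V (Fob R s) (v, w)) = fibre_pr1 V K s v w"
proof -
  let ?g = "\<lambda>(v, w). fibre_pr1 V K s v w"
  have g: "?g i \<in> Hom V (entry (Fob R s) i) (apex s)" if "i \<in> rows (Fob R s) \<times> cols (Fob R s)" for i
    using that fibre_pr1_in_Hom[OF s] by (auto simp: span_to_matrix_simps)
  note tuple = msum_tuple_in_Hom[OF span_to_matrix_obj[OF s] span_objD(3)[OF s] g]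
    msum_tuple_in[OF span_to_matrix_obj[OF s] span_objD(3)[OF s] g]
  show "on_apex (span_counit s) \<in> Hom V (msum V (Fob R s)) (apex s)"
    using tuple(1) by (simp add: span_counit_def)
  assume "v \<in> pts V K (span_dom s)" "w \<in> pts V K (span_cod s)"
  then show "Comp V (fibre_ob V K s v w) (msum V (Fob R s)) (apex s)
      (on_apex (span_counit s)) (msum_in V (Fob R s) (v, w)) = fibre_pr1 V K s v w"
    using tuple(2)[of "(v, w)"] by (simp add: span_counit_def span_to_matrix_simps)
qed

lemma span_counit_simps:
  "on_dom (span_counit s) = ob_counit (span_dom s)" "on_cod (span_counit s)
    = ob_counit (span_cod s)"
  by (simp_all add: span_counit_def)

text \<open>Both legs at once: \<pi> returns the first or the second point. On the summand at (v, w)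
  both sides are constant at \<open>\<pi> v w\<close>, on one side because the fibre lies over it,
  on the other because \<open>ob_counit\<close> evaluates the coprojection indexed by it.\<close>

lemma counit_leg_square:
  assumes s: "s \<in> Obj (span_cat V)" and a: "a \<in> Obj V" and l: "l \<in> Hom V (apex s) a"
    and m: "m \<in> Hom V (msum V (Fob R s)) (copower_ob V K (pts V K a))"
    and \<pi>: "\<And>v w. v \<in> pts V K (span_dom s) \<Longrightarrow> w \<in> pts V K (span_cod s) \<Longrightarrow> \<pi> v w \<in> pts V K a"
    and l_pr: "\<And>v w. v \<in> pts V K (span_dom s) \<Longrightarrow> w \<in> pts V K (span_cod s) \<Longrightarrow>
      Comp V (fibre_ob V K s v w) (apex s) a l (fibre_pr1 V K s v w)
      = konst V K (fibre_ob V K s v w) a (\<pi> v w)"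
    and m_in: "\<And>v w. v \<in> pts V K (span_dom s) \<Longrightarrow> w \<in> pts V K (span_cod s) \<Longrightarrow>
      Comp V (fibre_ob V K s v w) (msum V (Fob R s)) (copower_ob V K (pts V K a)) m
        (msum_in V (Fob R s) (v, w))
      = konst V K (fibre_ob V K s v w) (copower_ob V K (pts V K a))
          (copower_in V K (pts V K a) (\<pi> v w))"
  shows "Comp V (msum V (Fob R s)) (apex s) a l (on_apex (span_counit s))
    = Comp V (msum V (Fob R s)) (copower_ob V K (pts V K a)) a (ob_counit a) m"
proof -
  note p = span_to_matrix_obj[OF s] and S = span_objD(3)[OF s] and A = span_counit_apex_in_Hom[OF s]
  note M = msum_in_Obj[OF p]
  have small: "small (pts V K a)"
    using locally_small a One_in_Obj by (simp add: locally_small_def)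
  note C = copower_ob_in_Obj[OF small] and c = ob_counit_in_Hom[OF a]
  show ?thesis
  proof (rule msum_eqI[OF p a Comp_in_Hom[OF M S a A l] Comp_in_Hom[OF M C a m c]])
    fix i assume i: "i \<in> rows (Fob R s) \<times> cols (Fob R s)"
    obtain v w where vw: "i = (v, w)" by (cases i)
    with i have v: "v \<in> pts V K (span_dom s)" and w: "w \<in> pts V K (span_cod s)"
      by (simp_all add: span_to_matrix_simps)
    have e: "entry (Fob R s) i = fibre_ob V K s v w" using v w by
        (simp add: vw span_to_matrix_simps)
    note q = fibre_ob_in_Obj[OF s v w] and I = msum_in_in_Hom[OF p i, unfolded e]
    show "Comp V (entry (Fob R s) i) (msum V (Fob R s)) a
        (Comp V (msum V (Fob R s)) (apex s) a l (on_apex (span_counit s))) (msum_in V (Fob R s) i)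
      = Comp V (entry (Fob R s) i) (msum V (Fob R s)) a
        (Comp V (msum V (Fob R s)) (copower_ob V K (pts V K a)) a (ob_counit a) m)
          (msum_in V (Fob R s) i)"
      using Comp_assoc[OF q M S a I A l] Comp_assoc[OF q M C a I m c] m_in[OF v w] l_pr[OF v w]
        konst_postcomp[OF q C a copower_in_in_Hom[OF small \<pi>[OF v w]] c]
            ob_counit_in[OF a \<pi>[OF v w]]
        span_counit_apex_in[OF s v w]
      unfolding e by (simp add: vw)
  qed
qed

lemma span_counit_in_Hom:
  assumes s: "s \<in> Obj (span_cat V)"
  shows "span_counit s \<in> Hom (span_cat V) (Fob L (Fob R s)) s"
proof -
  let ?p = "Fob R s"
  note S = span_objD[OF s] and p = span_to_matrix_obj[OF s]
  have Lp: "left_leg (Fob L ?p) \<in> Hom V (msum V ?p) (copower_ob V K (pts V K (span_dom s)))"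
    "right_leg (Fob L ?p) \<in> Hom V (msum V ?p) (copower_ob V K (pts V K (span_cod s)))"
    using matrix_to_span_obj(1)[OF p]
    by (simp_all add: span_obj_iff matrix_to_span_simps span_to_matrix_simps(1,2))
  have "Comp V (msum V ?p) (apex s) (span_dom s) (left_leg s) (on_apex (span_counit s))
    = Comp V (msum V ?p) (copower_ob V K (pts V K (span_dom s))) (span_dom s)
        (ob_counit (span_dom s)) (left_leg (Fob L ?p))"
  proof (rule counit_leg_square[OF s S(1,4) Lp(1) _ left_leg_fibre_pr1[OF s]])
    fix v w assume vw: "v \<in> pts V K (span_dom s)" "w \<in> pts V K (span_cod s)"
    then show "Comp V (fibre_ob V K s v w) (msum V ?p) (copower_ob V K (pts V K (span_dom s)))
        (left_leg (Fob L ?p)) (msum_in V ?p (v, w))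
      = konst V K (fibre_ob V K s v w) (copower_ob V K (pts V K (span_dom s)))
        (copower_in V K (pts V K (span_dom s)) v)"
      using left_leg_msum_in[OF p, of "(v, w)"] by (simp add: span_to_matrix_simps)
  qed
  moreover have "Comp V (msum V ?p) (apex s) (span_cod s) (right_leg s) (on_apex (span_counit s))
    = Comp V (msum V ?p) (copower_ob V K (pts V K (span_cod s))) (span_cod s)
        (ob_counit (span_cod s)) (right_leg (Fob L ?p))"
  proof (rule counit_leg_square[OF s S(2,5) Lp(2) _ right_leg_fibre_pr1[OF s]])
    fix v w assume vw: "v \<in> pts V K (span_dom s)" "w \<in> pts V K (span_cod s)"
    then show "Comp V (fibre_ob V K s v w) (msum V ?p) (copower_ob V K (pts V K (span_cod s)))
        (right_leg (Fob L ?p)) (msum_in V ?p (v, w))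
      = konst V K (fibre_ob V K s v w) (copower_ob V K (pts V K (span_cod s)))
        (copower_in V K (pts V K (span_cod s)) w)"
      using right_leg_msum_in[OF p, of "(v, w)"] by (simp add: span_to_matrix_simps)
  qed
  ultimately show ?thesis
    unfolding span_hom_iff matrix_to_span_simps span_counit_simps span_to_matrix_simps(1,2)
    using span_counit_apex_in_Hom[OF s] ob_counit_in_Hom[OF S(1)] ob_counit_in_Hom[OF S(2)]
    by (simp add: span_to_matrix_simps(1,2))
qed

text \<open>Both composites send \<open>x\<close> to the coprojection at \<open>f x\<close>.\<close>

lemma set_unit_natural:
  assumes X: "small X" and Y: "small Y" and f: "f \<in> X \<rightarrow>\<^sub>E Y"
  shows "compose X (set_unit Y) f
    = compose X (Far (points V K) (copower_ob V K X) (copower_ob V K Y) (Far (copower V K) X Y f))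
        (set_unit X)"
  unfolding compose_def
proof (rule restrict_ext)
  fix x assume x: "x \<in> X"
  have f': "f \<in> X \<rightarrow> Y" and fx: "f x \<in> Y" using f x by auto
  show "set_unit Y (f x)
    = Far (points V K) (copower_ob V K X) (copower_ob V K Y) (Far (copower V K) X Y f)
        (set_unit X x)"
    using x fx copower_map_in[OF X Y f' x] copower_in_in_Hom[OF X x]
    by (simp add: set_unit_def points_simps)
qed

text \<open>On rows and columns this is \<open>set_unit_natural\<close>. For entries, both sides are
  maps into one fibre of \<open>Fob L q\<close>; projected to the sum of \<open>q\<close>, each
  becomes the entry of \<open>t\<close> followed by a coprojection, which is the restriction of the
  apex map of \<open>Far L p q t\<close> to the summand.\<close>

lemma matrix_unit_natural:
  assumes p: "p \<in> Obj (matrix_cat V)" and q: "q \<in> Obj (matrix_cat V)"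
    and t: "t \<in> Hom (matrix_cat V) p q"
  shows "Comp (matrix_cat V) p q (Fob R (Fob L q)) (matrix_unit q) t
    = Comp (matrix_cat V) p (Fob R (Fob L p)) (Fob R (Fob L q))
        (Far R (Fob L p) (Fob L q) (Far L p q t)) (matrix_unit p)"
proof -
  interpret M: category "matrix_cat V" by (rule matrix_cat_category) (rule category_axioms)
  note P = matrix_objD[OF p] and Q = matrix_objD[OF q] and T = matrix_homD[OF t]
  note Lp = matrix_to_span_obj(1)[OF p] and Lq = matrix_to_span_obj(1)[OF q]
  note Lt = matrix_to_span_hom[OF p q t]
  note RL = span_to_matrix_obj[OF Lp] span_to_matrix_obj[OF Lq]
  have fx: "on_rows t x \<in> rows q" if "x \<in> rows p" for x using T(1) that by auto
  have gy: "on_cols t y \<in> cols q" if "y \<in> cols p" for y using T(2) that by auto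
  show ?thesis
  proof (rule matrix_hom_eqI[OF M.Comp_in_Hom[OF p q RL(2) t matrix_unit_in_Hom[OF q]]
        M.Comp_in_Hom[OF p RL matrix_unit_in_Hom[OF p] span_to_matrix_hom[OF Lp Lq Lt]]])
    fix x y assume x: "x \<in> rows p" and y: "y \<in> cols p"
    let ?i = "(x, y)" and ?j = "(on_rows t x, on_cols t y)"
    have i: "?i \<in> rows p \<times> cols p" and j: "?j \<in> rows q \<times> cols q"
      using x y fx gy by simp_all
    define v where "v = copower_in V K (rows p) x"
    define w where "w = copower_in V K (cols p) y"
    define v' where "v' = copower_in V K (rows q) (on_rows t x)"
    define w' where "w' = copower_in V K (cols q) (on_cols t y)"
    have v: "v \<in> pts V K (span_dom (Fob L p))" and w: "w \<in> pts V K (span_cod (Fob L p))"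
      and v': "v' \<in> pts V K (span_dom (Fob L q))" and w': "w' \<in> pts V K (span_cod (Fob L q))"
      using P Q x y fx gy
      by (simp_all add: matrix_to_span_simps copower_in_in_Hom v_def w_def v'_def w'_def)
    \<comment> \<open>The image of a coprojection under \<open>Far L p q t\<close> is again a
      coprojection, so the fibre map ends in the fibre where the unit of \<open>q\<close>
      lands.\<close>
    have vw: "v' = Comp V (One K) (span_dom (Fob L p)) (span_dom (Fob L q))
        (on_dom (Far L p q t)) v"
      "w' = Comp V (One K) (span_cod (Fob L p)) (span_cod (Fob L q)) (on_cod (Far L p q t)) w"
      using copower_map_in[OF P(1) Q(1) T(1) x] copower_map_in[OF P(2) Q(2) T(2) y]
      by (simp_all add: matrix_to_span_simps v_def w_def v'_def w'_def)
    let ?f = "fibre_ob V K (Fob L p) v w" and ?f' = "fibre_ob V K (Fob L q) v' w'"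
    let ?m = "fibre_map V K (Fob L p) (Fob L q) v w v' w' (on_apex (Far L p q t))"
    let ?pr = "fibre_pr1 V K (Fob L p) v w" and ?pr' = "fibre_pr1 V K (Fob L q) v' w'"
    note E = entry_in_Obj[OF p i] entry_in_Obj[OF q j] and I
        = msum_in_in_Hom[OF p i] msum_in_in_Hom[OF q j]
    note M = msum_in_Obj[OF p] msum_in_Obj[OF q]
    have te: "on_entry t ?i \<in> Hom V (entry p ?i) (entry q ?j)"
      using T(4)[OF i] by simp
    note F = fibre_ob_in_Obj[OF Lp v w] fibre_ob_in_Obj[OF Lq v' w']
    note pr = fibre_pr1_in_Hom[OF Lp v w, unfolded matrix_to_span_simps]
      fibre_pr1_in_Hom[OF Lq v' w', unfolded matrix_to_span_simps]
    note m = fibre_map_in_Hom[OF Lp Lq Lt v w vw]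
    note up = matrix_unit_entry_in_Hom[OF p x y, folded v_def w_def]
    note uq = matrix_unit_entry_in_Hom[OF q fx[OF x] gy[OF y], folded v'_def w'_def]
    have "Comp V (entry p ?i) (entry q ?j) ?f' (on_entry (matrix_unit q) ?j) (on_entry t ?i)
      = Comp V (entry p ?i) ?f ?f' ?m (on_entry (matrix_unit p) ?i)"
    proof (rule fibre_eqI[OF Lq v' w' E(1) Comp_in_Hom[OF E F(2) te uq]
        Comp_in_Hom[OF E(1) F up m]])
      have "Comp V (entry p ?i) ?f' (msum V q) ?pr'
          (Comp V (entry p ?i) (entry q ?j) ?f' (on_entry (matrix_unit q) ?j) (on_entry t ?i))
        = Comp V (entry p ?i) (entry q ?j) (msum V q) (msum_in V q ?j) (on_entry t ?i)"
        using Comp_assoc[OF E F(2) M(2) te uq pr(2)]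
          fibre_pr1_matrix_unit[OF q fx[OF x] gy[OF y], folded v'_def w'_def] by simp
      also have "\<dots> = Comp V (entry p ?i) (msum V p) (msum V q) (on_apex (Far L p q t))
          (Comp V (entry p ?i) ?f (msum V p) ?pr (on_entry (matrix_unit p) ?i))"
        using matrix_to_span_apex_in[OF p q t i, of ?j]
          fibre_pr1_matrix_unit[OF p x y, folded v_def w_def] by simp
      also have "\<dots> = Comp V (entry p ?i) ?f (msum V q) (Comp V ?f ?f' (msum V q) ?pr' ?m)
          (on_entry (matrix_unit p) ?i)"
        using Comp_assoc[OF E(1) F(1) M up pr(1) matrix_to_span_apex_in_Hom[OF p q t]]
          fibre_pr1_map[OF Lp Lq Lt v w vw, unfolded matrix_to_span_simps] by simp
      also have "\<dots> = Comp V (entry p ?i) ?f' (msum V q) ?pr'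
          (Comp V (entry p ?i) ?f ?f' ?m (on_entry (matrix_unit p) ?i))"
        using Comp_assoc[OF E(1) F M(2) up m pr(2)] by simp
      finally show "Comp V (entry p ?i) ?f' (apex (Fob L q)) ?pr'
          (Comp V (entry p ?i) (entry q ?j) ?f' (on_entry (matrix_unit q) ?j) (on_entry t ?i))
        = Comp V (entry p ?i) ?f' (apex (Fob L q)) ?pr'
          (Comp V (entry p ?i) ?f ?f' ?m (on_entry (matrix_unit p) ?i))"
        by (simp add: matrix_to_span_simps)
    qed
    \<comment> \<open>Composition of matrix morphisms evaluates at images of \<open>x\<close> and
      \<open>y\<close>; these facts identify the points, fibres and maps that it picks with those of
      the equation just proved.\<close>
    moreover have "set_unit (rows p) x = v" "set_unit (cols p) y = w"
      "set_unit (rows q) (on_rows t x) = v'" "set_unit (cols q) (on_cols t y) = w'"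
      using x y fx gy by (simp_all add: set_unit_def v_def w_def v'_def w'_def)
    moreover have "entry (Fob R (Fob L p)) (v, w) = ?f" "entry (Fob R (Fob L q)) (v', w') = ?f'"
      using v w v' w' by (simp_all add: span_to_matrix_simps)
    moreover have "on_rows (Far R (Fob L p) (Fob L q) (Far L p q t)) v = v'"
      "on_cols (Far R (Fob L p) (Fob L q) (Far L p q t)) w = w'"
      using v w vw by (simp_all add: span_to_matrix_simps(4,5) points_simps)
    moreover have "on_entry (Far R (Fob L p) (Fob L q) (Far L p q t)) (v, w) = ?m"
      using v w by (simp add: span_to_matrix_simps(6) flip: vw)
    ultimately show "on_entry (Comp (matrix_cat V) p q (Fob R (Fob L q)) (matrix_unit q) t) (x, y)
      = on_entry (Comp (matrix_cat V) p (Fob R (Fob L p)) (Fob R (Fob L q))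
          (Far R (Fob L p) (Fob L q) (Far L p q t)) (matrix_unit p)) (x, y)"
      using x y by (simp add: matrix_comp_simps matrix_unit_simps)
  next
    fix x assume x: "x \<in> rows p"
    show "on_rows (Comp (matrix_cat V) p q (Fob R (Fob L q)) (matrix_unit q) t) x
      = on_rows (Comp (matrix_cat V) p (Fob R (Fob L p)) (Fob R (Fob L q))
          (Far R (Fob L p) (Fob L q) (Far L p q t)) (matrix_unit p)) x"
      using set_unit_natural[OF P(1) Q(1), of "on_rows t"] t
      by (simp add: matrix_comp_simps matrix_unit_simps span_to_matrix_simps(4) matrix_to_span_simps
          matrix_hom_iff)
  next
    fix y assume y: "y \<in> cols p"
    show "on_cols (Comp (matrix_cat V) p q (Fob R (Fob L q)) (matrix_unit q) t) y
      = on_cols (Comp (matrix_cat V) p (Fob R (Fob L p)) (Fob R (Fob L q))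
          (Far R (Fob L p) (Fob L q) (Far L p q t)) (matrix_unit p)) y"
      using set_unit_natural[OF P(2) Q(2), of "on_cols t"] t
      by (simp add: matrix_comp_simps matrix_unit_simps span_to_matrix_simps(5) matrix_to_span_simps
          matrix_hom_iff)
  qed
qed

text \<open>On the coprojection indexed by a point \<open>v\<close> both sides give the composite of
  \<open>f\<close> with \<open>v\<close>.\<close>

lemma ob_counit_natural:
  assumes a: "a \<in> Obj V" and b: "b \<in> Obj V" and f: "f \<in> Hom V a b"
  shows "Comp V (copower_ob V K (pts V K a)) (copower_ob V K (pts V K b)) b (ob_counit b)
      (Far (copower V K) (pts V K a) (pts V K b) (Far (points V K) a b f))
    = Comp V (copower_ob V K (pts V K a)) a b f (ob_counit a)"
proof -
  have small: "small (pts V K a)" "small (pts V K b)"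
    using locally_small a b One_in_Obj by (simp_all add: locally_small_def)
  have g: "Far (points V K) a b f \<in> pts V K a \<rightarrow> pts V K b"
    using a b f by (simp add: points_simps points_map_in)
  note C = copower_ob_in_Obj[OF small(1)] copower_ob_in_Obj[OF small(2)]
  note m = copower_map_in_Hom[OF small g]
  show ?thesis
  proof (rule copower_eqI[OF small(1) b Comp_in_Hom[OF C b m ob_counit_in_Hom[OF b]]
        Comp_in_Hom[OF C(1) a b ob_counit_in_Hom[OF a] f]])
    fix v assume v: "v \<in> pts V K a"
    note v' = copower_in_in_Hom[OF small(1) v]
    have fv: "Comp V (One K) a b f v \<in> pts V K b" using a b f v by (rule points_map_in)
    show "Comp V (One K) (copower_ob V K (pts V K a)) b
        (Comp V (copower_ob V K (pts V K a)) (copower_ob V K (pts V K b)) b (ob_counit b)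
          (Far (copower V K) (pts V K a) (pts V K b) (Far (points V K) a b f)))
        (copower_in V K (pts V K a) v)
      = Comp V (One K) (copower_ob V K (pts V K a)) b
        (Comp V (copower_ob V K (pts V K a)) a b f (ob_counit a)) (copower_in V K (pts V K a) v)"
      using Comp_assoc[OF One_in_Obj C b v' m ob_counit_in_Hom[OF b]]
        Comp_assoc[OF One_in_Obj C(1) a b v' ob_counit_in_Hom[OF a] f]
        copower_map_in[OF small g v] ob_counit_in[OF a v] ob_counit_in[OF b fv] v
      by (simp add: points_simps)
  qed
qed

text \<open>On the feet this is \<open>ob_counit_natural\<close>. On the summand at (v, w) both
  sides are the projection of the fibre followed by \<open>on_apex t\<close>, because
  \<open>fibre_map\<close> commutes with the projections, to which the counit restricts.\<close>

lemma span_counit_natural: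
  assumes s: "s \<in> Obj (span_cat V)" and s': "s' \<in> Obj (span_cat V)"
    and t: "t \<in> Hom (span_cat V) s s'"
  shows "Comp (span_cat V) (Fob L (Fob R s)) (Fob L (Fob R s')) s' (span_counit s')
      (Far L (Fob R s) (Fob R s') (Far R s s' t))
    = Comp (span_cat V) (Fob L (Fob R s)) s s' t (span_counit s)"
proof (rule span_mor.equality)
  note S = span_objD[OF s] and S' = span_objD[OF s'] and T = span_homD[OF t]
  note Rs = span_to_matrix_obj[OF s] and Rs' = span_to_matrix_obj[OF s']
  note Rt = span_to_matrix_hom[OF s s' t]
  note A = span_counit_apex_in_Hom[OF s] and A' = span_counit_apex_in_Hom[OF s']
  note M = msum_in_Obj[OF Rs] msum_in_Obj[OF Rs']
  note LRt = matrix_to_span_apex_in_Hom[OF Rs Rs' Rt]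
  have "Comp V (msum V (Fob R s)) (msum V (Fob R s')) (apex s') (on_apex (span_counit s'))
      (on_apex (Far L (Fob R s) (Fob R s') (Far R s s' t)))
    = Comp V (msum V (Fob R s)) (apex s) (apex s') (on_apex t) (on_apex (span_counit s))"
  proof (rule msum_eqI[OF Rs S'(3) Comp_in_Hom[OF M S'(3) LRt A']
      Comp_in_Hom[OF M(1) S(3) S'(3) A T(2)]])
    fix i assume i: "i \<in> rows (Fob R s) \<times> cols (Fob R s)"
    obtain v w where vw: "i = (v, w)" by (cases i)
    with i have v: "v \<in> pts V K (span_dom s)" and w: "w \<in> pts V K (span_cod s)"
      by (simp_all add: span_to_matrix_simps)
    define v' where "v' = Comp V (One K) (span_dom s) (span_dom s') (on_dom t) v"
    define w' where "w' = Comp V (One K) (span_cod s) (span_cod s') (on_cod t) w"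
    have v': "v' \<in> pts V K (span_dom s')" and w': "w' \<in> pts V K (span_cod s')"
      using v w S S' T by (simp_all add: v'_def w'_def points_map_in)
    have e: "entry (Fob R s) i = fibre_ob V K s v w" "entry (Fob R s') (v', w')
        = fibre_ob V K s' v' w'"
      "on_entry (Far R s s' t) i = fibre_map V K s s' v w v' w' (on_apex t)"
      "(v', w') = (on_rows (Far R s s' t) (fst i), on_cols (Far R s s' t) (snd i))"
      using v w v' w' by (simp_all add: vw span_to_matrix_simps points_simps v'_def w'_def)
    have j: "(v', w') \<in> rows (Fob R s') \<times> cols (Fob R s')"
      using v' w' by (simp add: span_to_matrix_simps)
    note F = fibre_ob_in_Obj[OF s v w] fibre_ob_in_Obj[OF s' v' w']
    note m = fibre_map_in_Hom[OF s s' t v w v'_def w'_def]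
    note I = msum_in_in_Hom[OF Rs i, unfolded e(1)] msum_in_in_Hom[OF Rs' j, unfolded e(2)]
    have "Comp V (fibre_ob V K s v w) (msum V (Fob R s)) (apex s')
        (Comp V (msum V (Fob R s)) (msum V (Fob R s')) (apex s') (on_apex (span_counit s'))
          (on_apex (Far L (Fob R s) (Fob R s') (Far R s s' t)))) (msum_in V (Fob R s) i)
      = Comp V (fibre_ob V K s v w) (msum V (Fob R s')) (apex s') (on_apex (span_counit s'))
        (Comp V (fibre_ob V K s v w) (fibre_ob V K s' v' w') (msum V (Fob R s'))
          (msum_in V (Fob R s') (v', w')) (fibre_map V K s s' v w v' w' (on_apex t)))"
      using Comp_assoc[OF F(1) M S'(3) I(1) LRt A']
        matrix_to_span_apex_in[OF Rs Rs' Rt i e(4), unfolded e(1-3)] by simp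
    also have "\<dots> = Comp V (fibre_ob V K s v w) (apex s) (apex s') (on_apex t) (fibre_pr1 V K s v w)"
      using Comp_assoc[OF F M(2) S'(3) m I(2) A'] span_counit_apex_in[OF s' v' w']
        fibre_pr1_map[OF s s' t v w v'_def w'_def] by simp
    also have "\<dots> = Comp V (fibre_ob V K s v w) (msum V (Fob R s)) (apex s')
        (Comp V (msum V (Fob R s)) (apex s) (apex s') (on_apex t) (on_apex (span_counit s)))
        (msum_in V (Fob R s) i)"
      using Comp_assoc[OF F(1) M(1) S(3) S'(3) I(1) A T(2)] span_counit_apex_in[OF s v w]
      by (simp add: vw)
    finally show "Comp V (entry (Fob R s) i) (msum V (Fob R s)) (apex s')
        (Comp V (msum V (Fob R s)) (msum V (Fob R s')) (apex s') (on_apex (span_counit s'))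
          (on_apex (Far L (Fob R s) (Fob R s') (Far R s s' t)))) (msum_in V (Fob R s) i)
      = Comp V (entry (Fob R s) i) (msum V (Fob R s)) (apex s')
        (Comp V (msum V (Fob R s)) (apex s) (apex s') (on_apex t) (on_apex (span_counit s)))
        (msum_in V (Fob R s) i)"
      unfolding e(1) .
  qed
  then show "on_apex (Comp (span_cat V) (Fob L (Fob R s)) (Fob L (Fob R s')) s' (span_counit s')
      (Far L (Fob R s) (Fob R s') (Far R s s' t)))
    = on_apex (Comp (span_cat V) (Fob L (Fob R s)) s s' t (span_counit s))"
    unfolding span_comp_simps matrix_to_span_simps .
qed (use span_objD[OF s] span_objD[OF s'] span_homD[OF t] in
    \<open>simp_all add: span_comp_simps matrix_to_span_simps(1,2,4,5) span_counit_simps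
      span_to_matrix_simps(1,2,4,5) ob_counit_natural\<close>)

section \<open>The unit and the counit as 2-cells of graphs\<close>

definition unit_cell :: "('u set, 'u \<Rightarrow> 'u, ('o, 'u) matrix, 'u matrix_mor) graph_cell" where
  "unit_cell = (set_unit, matrix_unit)"

definition counit_cell :: "('o, 'u, ('o, 'u) span, 'u span_mor) graph_cell" where
  "counit_cell = (ob_counit, span_counit)"

lemma unit_cell_2cell:
  "graph_2cell (matrix_graph V) (matrix_graph V) graph_mor_id
    (graph_mor_comp (points_graph_mor V K) (copower_graph_mor V K)) unit_cell"
proof (intro graph_2cell.intro graph_2cell_axioms.intro graph_mor_id_morphism
    graph_mor_comp_morphism[OF copower_graph_morphism points_graph_morphism] matrix_graph_cat_graph)
  show "nat_trans (G0 (matrix_graph V)) (G0 (matrix_graph V)) (M0 graph_mor_id)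
      (M0 (graph_mor_comp (points_graph_mor V K) (copower_graph_mor V K))) (fst unit_cell)"
  proof (intro nat_trans.intro nat_trans_axioms.intro)
    show "cat_functor (G0 (matrix_graph V)) (G0 (matrix_graph V)) (M0 graph_mor_id)"
      using functor_id_functor[OF set_cat_category] by (simp add: matrix_graph_def graph_mor_id_def)
    show "cat_functor (G0 (matrix_graph V)) (G0 (matrix_graph V))
        (M0 (graph_mor_comp (points_graph_mor V K) (copower_graph_mor V K)))"
      using functor_comp_functor[OF copower_functor points_functor]
      by (simp add: matrix_graph_def graph_mor_comp_def copower_graph_mor_def points_graph_mor_def)
  qed (simp_all add: matrix_graph_def graph_mor_id_def graph_mor_comp_def copower_graph_mor_def
      points_graph_mor_def functor_id_def functor_comp_def unit_cell_def copower_Fob points_simps(1)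
      set_unit_in_Hom set_unit_natural set_cat_def)
  show "nat_trans (G1 (matrix_graph V)) (G1 (matrix_graph V)) (M1 graph_mor_id)
      (M1 (graph_mor_comp (points_graph_mor V K) (copower_graph_mor V K))) (snd unit_cell)"
  proof (intro nat_trans.intro nat_trans_axioms.intro)
    show "cat_functor (G1 (matrix_graph V)) (G1 (matrix_graph V)) (M1 graph_mor_id)"
      using functor_id_functor[OF matrix_cat_category[OF category_axioms]]
      by (simp add: matrix_graph_def graph_mor_id_def)
    show "cat_functor (G1 (matrix_graph V)) (G1 (matrix_graph V))
        (M1 (graph_mor_comp (points_graph_mor V K) (copower_graph_mor V K)))"
      using functor_comp_functor[OF matrix_to_span_functor span_to_matrix_functor]
      by (simp add: matrix_graph_def graph_mor_comp_def copower_graph_mor_def points_graph_mor_def)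
  qed (simp_all add: matrix_graph_def graph_mor_id_def graph_mor_comp_def copower_graph_mor_def
      points_graph_mor_def functor_id_def functor_comp_def unit_cell_def
      matrix_unit_in_Hom matrix_unit_natural)
\<comment> \<open>Compatibility with source and target is built in: \<open>matrix_unit\<close> acts
  on rows and columns by \<open>set_unit\<close>.\<close>
qed (simp_all add: nat_eq_def post_whisker_def pre_whisker_def matrix_graph_def unit_cell_def
    matrix_unit_simps)

lemma counit_cell_2cell:
  "graph_2cell (span_graph V) (span_graph V)
    (graph_mor_comp (copower_graph_mor V K) (points_graph_mor V K)) graph_mor_id counit_cell"
proof (intro graph_2cell.intro graph_2cell_axioms.intro graph_mor_id_morphism
    graph_mor_comp_morphism[OF points_graph_morphism copower_graph_morphism] span_graph_cat_graph)
  show "nat_trans (G0 (span_graph V)) (G0 (span_graph V))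
      (M0 (graph_mor_comp (copower_graph_mor V K) (points_graph_mor V K))) (M0 graph_mor_id)
        (fst counit_cell)"
  proof (intro nat_trans.intro nat_trans_axioms.intro)
    show "cat_functor (G0 (span_graph V)) (G0 (span_graph V)) (M0 graph_mor_id)"
      using functor_id_functor[OF category_axioms] by (simp add: span_graph_def graph_mor_id_def)
    show "cat_functor (G0 (span_graph V)) (G0 (span_graph V))
        (M0 (graph_mor_comp (copower_graph_mor V K) (points_graph_mor V K)))"
      using functor_comp_functor[OF points_functor copower_functor]
      by (simp add: span_graph_def graph_mor_comp_def copower_graph_mor_def points_graph_mor_def)
  qed (simp_all add: span_graph_def graph_mor_id_def graph_mor_comp_def copower_graph_mor_def
      points_graph_mor_def functor_id_def functor_comp_def counit_cell_def copower_Fob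
          points_simps(1)
      ob_counit_in_Hom ob_counit_natural)
  show "nat_trans (G1 (span_graph V)) (G1 (span_graph V))
      (M1 (graph_mor_comp (copower_graph_mor V K) (points_graph_mor V K))) (M1 graph_mor_id)
        (snd counit_cell)"
  proof (intro nat_trans.intro nat_trans_axioms.intro)
    show "cat_functor (G1 (span_graph V)) (G1 (span_graph V)) (M1 graph_mor_id)"
      using functor_id_functor[OF span_cat_category[OF category_axioms]]
      by (simp add: span_graph_def graph_mor_id_def)
    show "cat_functor (G1 (span_graph V)) (G1 (span_graph V))
        (M1 (graph_mor_comp (copower_graph_mor V K) (points_graph_mor V K)))"
      using functor_comp_functor[OF span_to_matrix_functor matrix_to_span_functor]
      by (simp add: span_graph_def graph_mor_comp_def copower_graph_mor_def points_graph_mor_def)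
  qed (simp_all add: span_graph_def graph_mor_id_def graph_mor_comp_def copower_graph_mor_def
      points_graph_mor_def functor_id_def functor_comp_def counit_cell_def
      span_counit_in_Hom span_counit_natural)
\<comment> \<open>Likewise \<open>span_counit\<close> acts on the feet by
  \<open>ob_counit\<close>.\<close>
qed (simp_all add: nat_eq_def post_whisker_def pre_whisker_def span_graph_def counit_cell_def
    span_counit_simps)


section \<open>The triangle identities\<close>

text \<open>The coprojection of X * 1 at \<open>x\<close> is a point, hence an index of the outer
  copower. The first map sends it to the coprojection with that index, and evaluation returns the
  index.\<close>

lemma ob_triangle_L:
  assumes X: "small X"
  shows "Comp V (copower_ob V K X) (copower_ob V K (pts V K (copower_ob V K X))) (copower_ob V K X)
    (ob_counit (copower_ob V K X)) (Far (copower V K) X (pts V K (copower_ob V K X)) (set_unit X))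
    = Id V (copower_ob V K X)"
proof -
  note C = copower_ob_in_Obj[OF X]
  have Y: "small (pts V K (copower_ob V K X))"
    using locally_small C One_in_Obj by (simp add: locally_small_def)
  have u: "set_unit X \<in> X \<rightarrow> pts V K (copower_ob V K X)"
    using set_unit_in_Hom[OF X] by auto
  note CC = copower_ob_in_Obj[OF Y] and m = copower_map_in_Hom[OF X Y u] and e
      = ob_counit_in_Hom[OF C]
  show ?thesis
  proof (rule copower_eqI[OF X C Comp_in_Hom[OF C CC C m e] Id_in_Hom[OF C]])
    fix x assume x: "x \<in> X"
    note x' = copower_in_in_Hom[OF X x]
    show "Comp V (One K) (copower_ob V K X) (copower_ob V K X)
        (Comp V (copower_ob V K X) (copower_ob V K (pts V K (copower_ob V K X))) (copower_ob V K X)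
          (ob_counit (copower_ob V K X)) (Far (copower V K) X (pts V K (copower_ob V K X))
            (set_unit X)))
        (copower_in V K X x)
      = Comp V (One K) (copower_ob V K X) (copower_ob V K X) (Id V (copower_ob V K X))
          (copower_in V K X x)"
      using Comp_assoc[OF One_in_Obj C CC C x' m e] copower_map_in[OF X Y u x] ob_counit_in[OF C x']
        Comp_Id_left[OF One_in_Obj C x'] x
      by (simp add: set_unit_def)
  qed
qed

text \<open>On the feet this is \<open>ob_triangle_L\<close>. On the summand at (x, y) the unit
  enters a fibre, where the counit restricts to the projection, and projecting the unit gives back
  the coprojection at (x, y).\<close>

lemma span_triangle_L:
  assumes p: "p \<in> Obj (matrix_cat V)"
  shows "Comp (span_cat V) (Fob L p) (Fob L (Fob R (Fob L p))) (Fob L p)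
      (span_counit (Fob L p)) (Far L p (Fob R (Fob L p)) (matrix_unit p))
    = Id (span_cat V) (Fob L p)"
proof (rule span_mor.equality)
  let ?s = "Fob L p" and ?q = "Fob R (Fob L p)"
  note P = matrix_objD[OF p] and s = matrix_to_span_obj(1)[OF p]
  note q = span_to_matrix_obj[OF s] and u = matrix_unit_in_Hom[OF p]
  note M = msum_in_Obj[OF p] msum_in_Obj[OF q]
  note Lu = matrix_to_span_apex_in_Hom[OF p q u]
  note A = span_counit_apex_in_Hom[OF s, unfolded matrix_to_span_simps(3)]
  have "Comp V (msum V p) (msum V ?q) (msum V p) (on_apex (span_counit ?s))
      (on_apex (Far L p ?q (matrix_unit p)))
    = Id V (msum V p)"
  proof (rule msum_eqI[OF p M(1) Comp_in_Hom[OF M M(1) Lu A] Id_in_Hom[OF M(1)]])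
    fix i assume i: "i \<in> rows p \<times> cols p"
    obtain x y where xy: "i = (x, y)" by (cases i)
    with i have x: "x \<in> rows p" and y: "y \<in> cols p" by simp_all
    define v where "v = copower_in V K (rows p) x"
    define w where "w = copower_in V K (cols p) y"
    have v: "v \<in> pts V K (span_dom ?s)" and w: "w \<in> pts V K (span_cod ?s)"
      using P x y by (simp_all add: matrix_to_span_simps copower_in_in_Hom v_def w_def)
    have j: "(v, w) = (on_rows (matrix_unit p) (fst i), on_cols (matrix_unit p) (snd i))"
      using x y by (simp add: xy matrix_unit_simps set_unit_def v_def w_def)
    have vw: "(v, w) \<in> rows ?q \<times> cols ?q" and e: "entry ?q (v, w) = fibre_ob V K ?s v w"
      using v w by (simp_all add: span_to_matrix_simps)
    note E = entry_in_Obj[OF p i] and F = fibre_ob_in_Obj[OF s v w]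
    note I = msum_in_in_Hom[OF p i] msum_in_in_Hom[OF q vw, unfolded e]
    note ui = matrix_unit_entry_in_Hom[OF p x y, folded v_def w_def xy]
    have "Comp V (entry p i) (msum V p) (msum V p)
        (Comp V (msum V p) (msum V ?q) (msum V p) (on_apex (span_counit ?s))
          (on_apex (Far L p ?q (matrix_unit p))))
        (msum_in V p i)
      = Comp V (entry p i) (msum V ?q) (msum V p) (on_apex (span_counit ?s))
        (Comp V (entry p i) (fibre_ob V K ?s v w) (msum V ?q) (msum_in V ?q (v, w))
          (on_entry (matrix_unit p) i))"
      using Comp_assoc[OF E M M(1) I(1) Lu A] matrix_to_span_apex_in[OF p q u i j, unfolded e] by
          simp
    also have "\<dots> = Comp V (entry p i) (fibre_ob V K ?s v w) (msum V p) (fibre_pr1 V K ?s v w)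
        (on_entry (matrix_unit p) i)"
      using Comp_assoc[OF E F M(2,1) ui I(2) A] span_counit_apex_in[OF s v w, unfolded
          matrix_to_span_simps(3)]
      by simp
    also have "\<dots> = Comp V (entry p i) (msum V p) (msum V p) (Id V (msum V p)) (msum_in V p i)"
      using fibre_pr1_matrix_unit[OF p x y, folded v_def w_def xy] Comp_Id_left[OF E M(1) I(1)] by
          simp
    finally show "Comp V (entry p i) (msum V p) (msum V p)
        (Comp V (msum V p) (msum V ?q) (msum V p) (on_apex (span_counit ?s))
          (on_apex (Far L p ?q (matrix_unit p))))
        (msum_in V p i)
      = Comp V (entry p i) (msum V p) (msum V p) (Id V (msum V p)) (msum_in V p i)" .
  qed
  then show "on_apex (Comp (span_cat V) (Fob L p) (Fob L ?q) (Fob L p) (span_counit (Fob L p))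
      (Far L p ?q (matrix_unit p))) = on_apex (Id (span_cat V) (Fob L p))"
    unfolding span_comp_simps span_id_simps matrix_to_span_simps .
qed (use matrix_objD[OF p] in \<open>simp_all add: span_comp_simps span_id_simps
    matrix_to_span_simps(1,2,4,5)
    span_counit_simps span_to_matrix_simps(1,2) matrix_unit_simps ob_triangle_L\<close>)

lemma ob_triangle_R:
  assumes a: "a \<in> Obj V"
  shows "compose (pts V K a) (Far (points V K) (copower_ob V K (pts V K a)) a (ob_counit a))
    (set_unit (pts V K a)) = (\<lambda>v\<in>pts V K a. v)"
  unfolding compose_def
proof (rule restrict_ext)
  fix v assume v: "v \<in> pts V K a"
  have "small (pts V K a)"
    using locally_small a One_in_Obj by (simp add: locally_small_def)
  from copower_in_in_Hom[OF this v] show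
    "Far (points V K) (copower_ob V K (pts V K a)) a (ob_counit a) (set_unit (pts V K a) v) = v"
    using v ob_counit_in[OF a v] by (simp add: set_unit_def points_simps)
qed

text \<open>After projection to the apex of \<open>s\<close>, the fibre map of the counit becomes
  the counit following the projection of the inner fibre. The unit turns that projection into the
  coprojection at (v, w), on which the counit is \<open>fibre_pr1\<close>, the projection of the
  identity.\<close>

lemma matrix_triangle_R:
  assumes s: "s \<in> Obj (span_cat V)"
  shows "Comp (matrix_cat V) (Fob R s) (Fob R (Fob L (Fob R s))) (Fob R s)
      (Far R (Fob L (Fob R s)) s (span_counit s)) (matrix_unit (Fob R s))
    = Id (matrix_cat V) (Fob R s)"
proof -
  interpret M: category "matrix_cat V" by (rule matrix_cat_category) (rule category_axioms)
  let ?p = "Fob R s" and ?t = "Fob L (Fob R s)"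
  note S = span_objD[OF s] and p = span_to_matrix_obj[OF s]
  note t = matrix_to_span_obj(1)[OF p]
  note q = span_to_matrix_obj[OF t] and c = span_counit_in_Hom[OF s]
  show ?thesis
  proof (rule matrix_hom_eqI[OF M.Comp_in_Hom[OF p q p matrix_unit_in_Hom[OF p]
      span_to_matrix_hom[OF t s c]]
        M.Id_in_Hom[OF p]])
    fix v w assume vr: "v \<in> rows ?p" and wc: "w \<in> cols ?p"
    then have v: "v \<in> pts V K (span_dom s)" and w: "w \<in> pts V K (span_cod s)"
      by (simp_all add: span_to_matrix_simps)
    have i: "(v, w) \<in> rows ?p \<times> cols ?p" using vr wc by simp
    have e: "entry ?p (v, w) = fibre_ob V K s v w" using v w by (simp add: span_to_matrix_simps)
    define v' where "v' = copower_in V K (rows ?p) v"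
    define w' where "w' = copower_in V K (cols ?p) w"
    have v': "v' \<in> pts V K (span_dom ?t)" and w': "w' \<in> pts V K (span_cod ?t)"
      using matrix_objD[OF p] vr wc by
          (simp_all add: matrix_to_span_simps copower_in_in_Hom v'_def w'_def)
    \<comment> \<open>Evaluating the coprojection indexed by a point returns that point, so the
      fibre map of the counit leads back to the fibre over (v, w).\<close>
    have vw: "v = Comp V (One K) (span_dom ?t) (span_dom s) (on_dom (span_counit s)) v'"
      "w = Comp V (One K) (span_cod ?t) (span_cod s) (on_cod (span_counit s)) w'"
      using ob_counit_in[OF S(1) v] ob_counit_in[OF S(2) w]
      by (simp_all add: matrix_to_span_simps(1,2) span_to_matrix_simps(1,2) span_counit_simps
          v'_def w'_def)
    let ?f = "fibre_ob V K s v w" and ?f' = "fibre_ob V K ?t v' w'"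
    let ?m = "fibre_map V K ?t s v' w' v w (on_apex (span_counit s))"
    let ?u = "on_entry (matrix_unit ?p) (v, w)"
    note F = fibre_ob_in_Obj[OF s v w] fibre_ob_in_Obj[OF t v' w']
    note m = fibre_map_in_Hom[OF t s c v' w' vw]
    note u = matrix_unit_entry_in_Hom[OF p vr wc, folded v'_def w'_def, unfolded e]
    note pr = fibre_pr1_in_Hom[OF s v w] fibre_pr1_in_Hom[OF t v' w', unfolded
        matrix_to_span_simps(3)]
    note M = msum_in_Obj[OF p] and A = span_counit_apex_in_Hom[OF s]
    have "Comp V ?f ?f' ?f ?m ?u = Id V ?f"
    proof (rule fibre_eqI[OF s v w F(1) Comp_in_Hom[OF F F(1) u m] Id_in_Hom[OF F(1)]])
      have "Comp V ?f ?f (apex s) (fibre_pr1 V K s v w) (Comp V ?f ?f' ?f ?m ?u)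
        = Comp V ?f ?f' (apex s) (Comp V ?f' (msum V ?p) (apex s) (on_apex (span_counit s))
            (fibre_pr1 V K ?t v' w')) ?u"
        using Comp_assoc[OF F F(1) S(3) u m pr(1)]
          fibre_pr1_map[OF t s c v' w' vw, unfolded matrix_to_span_simps(3)] by simp
      also have "\<dots> = Comp V ?f (msum V ?p) (apex s) (on_apex (span_counit s)) (msum_in V ?p (v, w))"
        using Comp_assoc[OF F M S(3) u pr(2) A]
          fibre_pr1_matrix_unit[OF p vr wc, folded v'_def w'_def, unfolded e] by simp
      also have "\<dots> = Comp V ?f ?f (apex s) (fibre_pr1 V K s v w) (Id V ?f)"
        using span_counit_apex_in[OF s v w] Comp_Id_right[OF F(1) S(3) pr(1)] by simp
      finally show "Comp V ?f ?f (apex s) (fibre_pr1 V K s v w) (Comp V ?f ?f' ?f ?m ?u)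
        = Comp V ?f ?f (apex s) (fibre_pr1 V K s v w) (Id V ?f)" .
    qed
    moreover have "on_rows (matrix_unit ?p) v = v'" "on_cols (matrix_unit ?p) w = w'"
      using vr wc by (simp_all add: matrix_unit_simps set_unit_def v'_def w'_def)
    moreover have "entry (Fob R ?t) (v', w') = ?f'"
      using v' w' by (simp add: span_to_matrix_simps)
    moreover have "on_rows (Far R ?t s (span_counit s)) v'
        = v" "on_cols (Far R ?t s (span_counit s)) w' = w"
      using v' w' vw by (simp_all add: span_to_matrix_simps(4,5) points_simps)
    moreover have "on_entry (Far R ?t s (span_counit s)) (v', w') = ?m"
      using v' w' by (simp add: span_to_matrix_simps(6) flip: vw)
    ultimately show "on_entry (Comp (matrix_cat V) ?p (Fob R ?t) ?p (Far R ?t s (span_counit s))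
        (matrix_unit ?p)) (v, w)
      = on_entry (Id (matrix_cat V) ?p) (v, w)"
      using vr wc e by (simp add: matrix_comp_simps matrix_id_simps)
  qed (use ob_triangle_R[OF S(1)] ob_triangle_R[OF S(2)] in \<open>simp_all add: matrix_comp_simps
      matrix_id_simps
      matrix_unit_simps span_to_matrix_simps(1,2,4,5) matrix_to_span_simps(1,2) span_counit_simps\<close>)
qed

lemma copower_points_adjunction:
  "graph_adjunction (matrix_graph V) (span_graph V) (copower_graph_mor V K) (points_graph_mor V K)
    unit_cell counit_cell"
proof (intro graph_adjunction.intro graph_adjunction_axioms.intro copower_graph_morphism
    points_graph_morphism unit_cell_2cell counit_cell_2cell)
  let ?L = "copower_graph_mor V K" and ?R = "points_graph_mor V K"
  \<comment> \<open>Unfolded, each triangle identity is a pair of pointwise equations, one on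
    0-cells and one on 1-cells.\<close>
  note defs = cell_eq_def cell_vcomp_def cell_pre_whisker_def cell_post_whisker_def cell_id_def
      nat_eq_def
    nat_vcomp_def nat_id_def pre_whisker_def post_whisker_def graph_mor_comp_def graph_mor_id_def
    functor_comp_def functor_id_def copower_graph_mor_def points_graph_mor_def unit_cell_def
    counit_cell_def copower_Fob points_simps(1)
  show "cell_eq (matrix_graph V)
      (cell_vcomp (span_graph V) ?L (graph_mor_comp ?L (graph_mor_comp ?R ?L)) ?L
        (cell_pre_whisker counit_cell ?L)
        (cell_post_whisker ?L graph_mor_id (graph_mor_comp ?R ?L) unit_cell))
      (cell_id (span_graph V) ?L)"
    using ob_triangle_L span_triangle_L by
        (simp add: defs matrix_graph_def span_graph_def set_cat_def)
  show "cell_eq (span_graph V)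
      (cell_vcomp (matrix_graph V) ?R (graph_mor_comp ?R (graph_mor_comp ?L ?R)) ?R
        (cell_post_whisker ?R (graph_mor_comp ?L ?R) graph_mor_id counit_cell)
        (cell_pre_whisker unit_cell ?R))
      (cell_id (matrix_graph V) ?R)"
    using ob_triangle_R matrix_triangle_R by
        (simp add: defs matrix_graph_def span_graph_def set_cat_def)
qed

end

theorem proposition2p1:
  fixes V :: "('o, 'u) cat_data" and K :: "('o, 'u) cart_data"
  assumes "infinite (UNIV :: 'u set)"
    and "category V" and "locally_small V"
    and "cartesian_monoidal V K" and "has_finite_limits V"
    and "distributive V K"
  shows "\<exists>\<eta> \<epsilon>. graph_adjunction (matrix_graph V) (span_graph V)
    (copower_graph_mor V K) (points_graph_mor V K) \<eta> \<epsilon>"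
proof -
  interpret matrix_span V K
    using assms by (simp add: matrix_span_def matrix_span_axioms_def distributive_def)
  show ?thesis
    using copower_points_adjunction by blast
qed

end
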